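(* In the coloured tree model described in the context, suppose that the following conditions hold for all $i,j\in\{1,\dots,d\}$: (i) $[0,1]\subseteq\mathbb{D}$ and $0\in\mathrm{Int}(\mathbb{D})$; (ii) $\mathbb{E}|\log\tilde\xi_{ij}|<\infty$ and $\mathbb{E}|\tilde\xi_{ij}\log\tilde\xi_{ij}|<\infty$; (iii) the function $s\mapsto\mathbb{E}[\tilde\xi_{ij}^{\,s}]$ belongs to $C^2(\mathbb{R}_+)$. Suppose moreover that (A1) $\lambda:=\inf_{s\ge 0}\rho(s)<1$; (A2) $\mu:=-\Lambda'(0)>0$ (equivalently, $\rho'(0)<0$). Then the limit $$\lim_{t\to\infty}\frac{\log\mathbb{E}[Z(e^{-t})]}{t}$$ exists and is given by $$M=\max_{u\in[0,\mu]}\frac{\log d-\Lambda^*(-u)}{u}.$$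
   Context: Let $d\ge 2$ and let $T_d$ be the $d$-ary regular rooted tree with vertex set $\mathbb{V}$ and root $u_0$ (every vertex has exactly $d$ children). For $u\in\mathbb{V}$, $\ell(u)$ is the unique self-avoiding path from the root to $u$, $|u|$ is its number of edges, and $\mathbb{V}_n=\{u:|u|=n\}$. Colouring: the root is given an arbitrary colour in $\{1,\dots,d\}$. Recursively in the levels, and independently for each vertex, the $d$ children of each vertex are coloured with $d$ distinct colours, all $d!$ possibilities being equally likely. The colour of $u$ is $c(u)$. Labels: $\tilde\xi_{ij}$, $i,j\in\{1,\dots,d\}$, are $d^2$ strictly positive, non-degenerate random variables with a given joint distribution. Given the colouring, each edge $(u,w)$ with $u$ the parent of $w$ carries a random variable $\zeta_{uw}$ distributed as $\tilde\xi_{c(u)c(w)}$. For any edges $(u_1,w_1),\dots,(u_m,w_m)$ with $u_i$ the parent of $w_i$ and the parents $u_i$ pairwise distinct, the labels $\zeta_{u_1w_1},\dots,\zeta_{u_mw_m}$ are independent. $\mathbb{P}$ and $\mathbb{E}$ refer to the joint law of the colouring and the labels. The value $\zeta[u]$ of a vertex $u$ is the product of the labels on the edges of $\ell(u)$ (equal to $1$ for the root), and for $x>0$, $Z(x)=\mathrm{card}\{u\in\mathbb{V}:\zeta[u]\ge x\}$. $\mathbb{D}=\{s\in\mathbb{R}:\mathbb{E}[\tilde\xi_{ij}^{\,s}]<\infty\ \forall i,j\}$ and $\mathrm{Int}(\mathbb{D})$ is its interior. $m(s)$ is the $d\times d$ matrix with entries $\mathbb{E}[\tilde\xi_{ij}^{\,s}]$,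 and $\rho(s)>0$ is its largest (Perron–Frobenius) eigenvalue. $\Lambda(s)=\log\rho(s)-\log d$, and $\Lambda^*(z)=\sup_{s\ge0}(sz-\Lambda(s))$ for $z\in\mathbb{R}$. In the formula for $M$, the value at $u=0$ is understood as the limit as $u\downarrow0$, which is $-\infty$ under (A1). *)

theory Defs
  imports "HOL-Probability.Probability"
begin

section \<open>The tree\<close>

text \<open>
  A finite type \<open>'c\<close> with \<open>d = CARD('c)\<close> elements serves as the set of colours. The
  vertices of the \<open>d\<close>-ary tree are the words over a \<open>d\<close>-letter alphabet, for which
  \<open>'c\<close> is reused: the root is \<open>[]\<close> and the children of \<open>u\<close> are the words \<open>u @ [k]\<close>.
  The letters only name positions in the tree and are unrelated to the colour of a vertex.
\<close>

definition tree_edges :: "('c list \<times> 'c list) set" where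
  "tree_edges = {(u, w). \<exists>k. w = u @ [k]}"

text \<open>The vertices on the path from the root to \<open>u\<close> are the prefixes \<open>take i u\<close>.\<close>

definition vertex_value :: "('c list \<Rightarrow> 'c list \<Rightarrow> 'w \<Rightarrow> real) \<Rightarrow> 'c list \<Rightarrow> 'w \<Rightarrow> real" where
  "vertex_value \<zeta> u \<omega> = (\<Prod>i<length u. \<zeta> (take i u) (take (Suc i) u) \<omega>)"

text \<open>The measure \<open>count_space UNIV\<close> gives infinite sets the value \<open>\<infinity>\<close>, unlike \<open>card\<close>.\<close>

definition Z_count :: "('c list \<Rightarrow> 'c list \<Rightarrow> 'w \<Rightarrow> real) \<Rightarrow> real \<Rightarrow> 'w \<Rightarrow> ennreal" where
  "Z_count \<zeta> x \<omega> = emeasure (count_space UNIV) {u. x \<le> vertex_value \<zeta> u \<omega>}"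

definition expected_Z :: "'w measure \<Rightarrow> ('c list \<Rightarrow> 'c list \<Rightarrow> 'w \<Rightarrow> real) \<Rightarrow> real \<Rightarrow> ennreal" where
  "expected_Z P \<zeta> x = (\<integral>\<^sup>+ \<omega>. Z_count \<zeta> x \<omega> \<partial>P)"

definition ln_ennreal :: "ennreal \<Rightarrow> ereal" where
  "ln_ennreal x = (if x = 0 then -\<infinity> else if x = \<top> then \<infinity> else ereal (ln (enn2real x)))"


section \<open>The random colouring and the labels\<close>

definition colouring_algebra :: "'w measure \<Rightarrow> ('c list \<Rightarrow> 'w \<Rightarrow> 'c) \<Rightarrow> 'w measure" where
  "colouring_algebra P c =
     vimage_algebra (space P) (\<lambda>\<omega> u. c u \<omega>) (\<Pi>\<^sub>M u\<in>UNIV. count_space UNIV)"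

definition prob_given :: "'w measure \<Rightarrow> 'w measure \<Rightarrow> 'w set \<Rightarrow> 'w \<Rightarrow> real" where
  "prob_given P F A = real_cond_exp P F (indicator A)"

text \<open>
  The variables \<open>\<xi> i j\<close> live on a space \<open>N\<close> of their own, which carries their given joint
  distribution; the colouring \<open>c\<close> and the labels \<open>\<zeta>\<close> live on \<open>P\<close>. The value \<open>\<zeta> u w\<close> is only
  meaningful when \<open>(u, w)\<close> is an edge.

  The function \<open>\<lambda>k. c (u @ [k]) \<omega>\<close> describes how the children of \<open>u\<close> are coloured; there are
  \<open>d!\<close> bijections. Both label axioms are conditional on the whole colouring. Nothing is
  required of the joint law of the labels on the edges below one and the same vertex.
\<close>

locale coloured_tree = P: prob_space P + N: prob_space N
  for P :: "'w measure" and N :: "'v measure" +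
  fixes \<xi> :: "'c::finite \<Rightarrow> 'c \<Rightarrow> 'v \<Rightarrow> real"
    and root_colour :: 'c
    and c :: "'c list \<Rightarrow> 'w \<Rightarrow> 'c"
    and \<zeta> :: "'c list \<Rightarrow> 'c list \<Rightarrow> 'w \<Rightarrow> real"
  assumes degree: "CARD('c) \<ge> 2"
    and \<xi>_measurable: "\<And>i j. \<xi> i j \<in> borel_measurable N"
    and \<xi>_positive: "\<And>i j. AE x in N. 0 < \<xi> i j x"
    and \<xi>_nondegenerate: "\<And>i j. \<not> (\<exists>a. AE x in N. \<xi> i j x = a)"
    and colour_measurable: "\<And>u. c u \<in> measurable P (count_space UNIV)"
    and colour_root: "\<And>\<omega>. \<omega> \<in> space P \<Longrightarrow> c [] \<omega> = root_colour"
    and colour_children_uniform: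
      "\<And>u. distr P (count_space UNIV) (\<lambda>\<omega> k. c (u @ [k]) \<omega>)
             = measure_pmf (pmf_of_set {f :: 'c \<Rightarrow> 'c. bij f})"
    and colour_children_indep:
      "P.indep_vars (\<lambda>_. count_space UNIV) (\<lambda>u \<omega> k. c (u @ [k]) \<omega>) UNIV"
    and label_measurable: "\<And>u w. (u, w) \<in> tree_edges \<Longrightarrow> \<zeta> u w \<in> borel_measurable P"
    and label_law:
      "\<And>u w B. (u, w) \<in> tree_edges \<Longrightarrow> B \<in> sets borel \<Longrightarrow>
         AE \<omega> in P. prob_given P (colouring_algebra P c) {\<omega> \<in> space P. \<zeta> u w \<omega> \<in> B} \<omega>
                    = measure N {x \<in> space N. \<xi> (c u \<omega>) (c w \<omega>) x \<in> B}"
    and label_indep: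
      "\<And>E B. finite E \<Longrightarrow> E \<subseteq> tree_edges \<Longrightarrow> inj_on fst E \<Longrightarrow>
         (\<And>e. e \<in> E \<Longrightarrow> B e \<in> sets borel) \<Longrightarrow>
         AE \<omega> in P.
           prob_given P (colouring_algebra P c)
             {\<omega> \<in> space P. \<forall>(u, w)\<in>E. \<zeta> u w \<omega> \<in> B (u, w)} \<omega>
           = (\<Prod>(u, w)\<in>E. prob_given P (colouring_algebra P c)
                             {\<omega> \<in> space P. \<zeta> u w \<omega> \<in> B (u, w)} \<omega>)"


section \<open>Moments, spectral quantities and rate function\<close>

definition moment_domain :: "'v measure \<Rightarrow> ('c::finite \<Rightarrow> 'c \<Rightarrow> 'v \<Rightarrow> real) \<Rightarrow> real set" where
  "moment_domain N \<xi> = {s. \<forall>i j. integrable N (\<lambda>x. \<xi> i j x powr s)}"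

definition moment_matrix ::
    "'v measure \<Rightarrow> ('c::finite \<Rightarrow> 'c \<Rightarrow> 'v \<Rightarrow> real) \<Rightarrow> real \<Rightarrow> real ^ 'c ^ 'c" where
  "moment_matrix N \<xi> s = (\<chi> i j. \<integral>x. \<xi> i j x powr s \<partial>N)"

definition real_eigenvalue :: "real ^ 'c ^ 'c \<Rightarrow> real \<Rightarrow> bool" where
  "real_eigenvalue A l \<longleftrightarrow> (\<exists>v. v \<noteq> 0 \<and> A *v v = l *s v)"

text \<open>For \<open>s\<close> in the moment domain the matrix is positive, so its Perron-Frobenius eigenvalue
  is the largest of its real eigenvalues.\<close>

definition rho :: "'v measure \<Rightarrow> ('c::finite \<Rightarrow> 'c \<Rightarrow> 'v \<Rightarrow> real) \<Rightarrow> real \<Rightarrow> real" where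
  "rho N \<xi> s = (GREATEST l. real_eigenvalue (moment_matrix N \<xi> s) l)"

definition Lambda :: "'v measure \<Rightarrow> ('c::finite \<Rightarrow> 'c \<Rightarrow> 'v \<Rightarrow> real) \<Rightarrow> real \<Rightarrow> real" where
  "Lambda N \<xi> s = ln (rho N \<xi> s) - ln (real CARD('c))"

definition Lambda_star :: "'v measure \<Rightarrow> ('c::finite \<Rightarrow> 'c \<Rightarrow> 'v \<Rightarrow> real) \<Rightarrow> real \<Rightarrow> ereal" where
  "Lambda_star N \<xi> z = (SUP s\<in>{0..}. ereal (s * z - Lambda N \<xi> s))"

definition growth_quotient ::
    "'v measure \<Rightarrow> ('c::finite \<Rightarrow> 'c \<Rightarrow> 'v \<Rightarrow> real) \<Rightarrow> real \<Rightarrow> ereal" where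
  "growth_quotient N \<xi> u =
     (let q = (\<lambda>v. (ereal (ln (real CARD('c))) - Lambda_star N \<xi> (- v)) / ereal v)
      in if u = 0 then Lim (at_right 0) q else q u)"

text \<open>Derivatives at boundary points of \<open>S\<close> are one-sided.\<close>

definition C2_on :: "real set \<Rightarrow> (real \<Rightarrow> real) \<Rightarrow> bool" where
  "C2_on S f \<longleftrightarrow>
     (\<exists>f' f''. (\<forall>s\<in>S. (f has_real_derivative f' s) (at s within S)) \<and>
               (\<forall>s\<in>S. (f' has_real_derivative f'' s) (at s within S)) \<and>
               continuous_on S f'')"

end

theory Submission
  imports Defs
begin

text \<open>
  Write \<open>f = ln \<circ> \<rho>\<close> and \<open>d\<close> for the number of colours. The whole theorem is about the first
  zero \<open>\<alpha>\<close> of \<open>f\<close> on the positive half-line: both the growth rate of \<open>E Z(e\<^sup>-\<^sup>t)\<close> and the maximum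
  of the growth quotient are equal to it.

  Along the path to a vertex the colours are independent and uniform, and given the colours
  the labels are independent. Hence \<open>E \<zeta>[u]\<^sup>s\<close> is \<open>d\<^sup>-\<^sup>n\<close> times a sum over colour paths of products
  of entries of \<open>m(s)\<close>, where \<open>n = |u|\<close> (\<open>vertex_moment\<close>). Comparison with a Perron
  eigenvector, which exists by Brouwer's theorem, shows that this is \<open>(\<rho>(s)/d)\<^sup>n\<close> up to constant
  factors (\<open>vertex_moment_bounds\<close>); summed over level \<open>n\<close> it becomes \<open>\<rho>(s)\<^sup>n\<close>.

  The function \<open>f\<close> is convex, because a weighted geometric mean of Perron eigenvectors is a
  supersolution for the intermediate exponent (\<open>rho_log_convex_ineq\<close>). It is positive at \<open>0\<close>
  and negative somewhere, so it has a zero \<open>\<alpha>\<close> with a subgradient \<open>-k < 0\<close>, and \<open>k \<le> \<mu>\<close> since the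
  slope of \<open>f\<close> at \<open>0\<close> is \<open>-\<mu>\<close> (\<open>convex_zero_slope\<close>). This last point needs \<open>f\<close> to be
  differentiable at \<open>0\<close>, which follows from a first-order perturbation of the Perron
  eigenvector (\<open>rho_differentiable_at_0\<close>).

  \<^emph>\<open>The growth quotient.\<close> At \<open>u > 0\<close> it is the infimum of \<open>s + f(s)/u\<close> over \<open>s \<ge> 0\<close>. Taking \<open>s = \<alpha>\<close>
  bounds it by \<open>\<alpha>\<close>, and for \<open>u = k\<close> the subgradient inequality \<open>f(s) \<ge> k(\<alpha> - s)\<close> gives equality.

  \<^emph>\<open>The upper bound.\<close> If \<open>s\<close> is slightly larger than \<open>\<alpha>\<close> then \<open>\<rho>(s) < 1\<close>, and Markov's inequality
  bounds \<open>E Z(e\<^sup>-\<^sup>t)\<close> by a convergent geometric series times \<open>e\<^sup>s\<^sup>t\<close> (\<open>expected_Z_upper\<close>).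

  \<^emph>\<open>The lower bound.\<close> Only one level \<open>n\<close>, proportional to \<open>t\<close>, is needed. In the \<open>s\<close>-th moment of
  that level, with \<open>s\<close> slightly smaller than \<open>\<alpha>\<close>, the values outside a window
  \<open>[e\<^sup>-\<^sup>b\<^sup>n, e\<^sup>-\<^sup>a\<^sup>n]\<close> contribute an exponentially small proportion, provided that \<open>a\<close> and \<open>b\<close> lie
  strictly on either side of the slopes of \<open>-f\<close> around \<open>s\<close> (\<open>value_tail_lower\<close>, \<open>expected_Z_lower\<close>).
  The window yields the rate \<open>sa/b\<close>. Convexity makes the slopes converge as \<open>s\<close> increases to \<open>\<alpha>\<close>,
  so that \<open>a/b\<close> can be taken close to \<open>1\<close> (\<open>convex_almost_linear_left_of_zero\<close>).
\<close>

section \<open>Positive matrices\<close>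

text \<open>
  Brouwer's theorem applies to the map \<open>x \<mapsto> A x\<close>, rescaled to have coordinate sum \<open>1\<close>, on the
  standard simplex. A fixed point is a nonnegative eigenvector, and a positive matrix sends
  every nonzero nonnegative vector to a positive one.
\<close>
lemma perron_eigenvector:
  fixes A :: "real ^ 'n::finite ^ 'n"
  assumes pos: "\<And>i j. 0 < A $ i $ j"
  obtains v r where "\<And>i. 0 < v $ i" and "0 < r" and "A *v v = r *s v"
proof -
  define S where "S = {x :: real ^ 'n. (\<forall>i. 0 \<le> x $ i) \<and> (\<Sum>i\<in>UNIV. x $ i) = 1}"
  define total where "total = (\<lambda>x :: real ^ 'n. \<Sum>i\<in>UNIV. (A *v x) $ i)"
  define f where "f = (\<lambda>x. (1 / total x) *s (A *v x))"
  have entry: "(A *v x) $ i = (\<Sum>j\<in>UNIV. A $ i $ j * x $ j)" for x i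
    by (simp add: matrix_vector_mult_def)
  have pos_image: "0 < (A *v x) $ i" if "x \<in> S" for x i
  proof -
    have "\<exists>j. 0 < x $ j"
    proof (rule ccontr)
      assume "\<not> ?thesis"
      then have "x $ j = 0" for j using that by (auto simp: S_def not_less intro: antisym)
      then show False using that by (simp add: S_def)
    qed
    then obtain j where j: "0 < x $ j" ..
    show ?thesis
      unfolding entry using that pos j
      by (intro sum_pos2[where i = j]) (auto simp: S_def intro: less_imp_le mult_nonneg_nonneg)
  qed
  have pos_total: "0 < total x" if "x \<in> S" for x
    unfolding total_def using that by (intro sum_pos) (auto simp: pos_image)
  have "compact S"
  proof (rule compact_eq_bounded_closed[THEN iffD2], intro conjI)
    show "bounded S"
    proof (rule boundedI)
      fix x assume "x \<in> S"
      then show "norm x \<le> 1"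
        using norm_le_l1_cart[of x] by (simp add: S_def)
    qed
    have "S = (\<Inter>i. {x. 0 \<le> x $ i}) \<inter> {x. (\<Sum>i\<in>UNIV. x $ i) = 1}"
      by (auto simp: S_def)
    then show "closed S"
      by (auto intro!: closed_Int closed_INT closed_Collect_le closed_Collect_eq continuous_intros)
  qed
  moreover have "convex S"
    by (auto simp: convex_def S_def sum.distrib sum_distrib_left[symmetric])
  moreover have "S \<noteq> {}"
  proof -
    have "(\<chi> i. 1 / real CARD('n)) \<in> S" by (simp add: S_def)
    then show ?thesis by blast
  qed
  moreover have "continuous_on S f"
  proof -
    have "f = (\<lambda>x. \<chi> i. (\<Sum>j\<in>UNIV. A $ i $ j * x $ j) / (\<Sum>i\<in>UNIV. \<Sum>j\<in>UNIV. A $ i $ j * x $ j))"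
      by (simp add: f_def total_def entry fun_eq_iff vec_eq_iff)
    moreover have "continuous_on S \<dots>"
      using pos_total
      by (intro continuous_on_vec_lambda continuous_intros) (auto simp: total_def entry less_le)
    ultimately show ?thesis by simp
  qed
  moreover have "f \<in> S \<rightarrow> S"
  proof
    fix x assume x: "x \<in> S"
    have entry_f: "f x $ i = (A *v x) $ i / total x" for i by (simp add: f_def)
    have "(\<Sum>i\<in>UNIV. f x $ i) = total x / total x"
      unfolding entry_f by (simp only: total_def sum_divide_distrib)
    then show "f x \<in> S"
      using x pos_total[OF x] pos_image[OF x]
      by (auto simp: S_def f_def intro!: less_imp_le)
  qed
  ultimately obtain v where v: "v \<in> S" "f v = v"
    using brouwer by blast
  have eq: "A *v v = total v *s v"
  proof -
    have "total v *s f v = A *v v"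
      using pos_total[OF v(1)] by (simp add: f_def vector_smult_assoc)
    then show ?thesis using v by simp
  qed
  have "0 < v $ i" for i
  proof -
    have "0 < total v * v $ i"
      using pos_image[OF v(1), of i] eq by simp
    then show ?thesis using pos_total[OF v(1)] by (simp add: zero_less_mult_iff)
  qed
  then show thesis using that eq pos_total[OF v(1)] by blast
qed

text \<open>
  The Collatz-Wielandt upper bound: compare an eigenvector \<open>w\<close> with \<open>z\<close> at an index where
  \<open>\<bar>w\<^sub>i\<bar> / z\<^sub>i\<close> is largest. It serves both to identify the Perron eigenvalue as the
  largest one and to estimate it from trial vectors.
\<close>
lemma eigenvalue_le_supersolution:
  fixes A :: "real ^ 'n::finite ^ 'n"
  assumes nonneg: "\<And>i j. 0 \<le> A $ i $ j" and z: "\<And>i. 0 < z $ i"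
    and super: "\<And>i. (A *v z) $ i \<le> k * z $ i"
    and l: "real_eigenvalue A l"
  shows "l \<le> k"
proof -
  obtain w where w: "w \<noteq> 0" "A *v w = l *s w"
    using l by (auto simp: real_eigenvalue_def)
  define q where "q = (\<lambda>i. \<bar>w $ i\<bar> / z $ i)"
  define M where "M = Max (range q)"
  have q_le: "q i \<le> M" for i unfolding M_def by (rule Max_ge) auto
  have "M \<in> range q" unfolding M_def by (rule Max_in) auto
  then obtain i where i: "q i = M" by auto
  have bound: "\<bar>w $ j\<bar> \<le> M * z $ j" for j
    using q_le[of j] z[of j] by (simp add: q_def field_simps)
  have wi: "\<bar>w $ i\<bar> = M * z $ i"
    using i z[of i] by (auto simp: q_def field_simps)
  obtain j where "w $ j \<noteq> 0" using w(1) by (auto simp: vec_eq_iff)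
  then have "0 < q j" using z[of j] by (simp add: q_def)
  then have M: "0 < M" using q_le[of j] by linarith
  have "\<bar>l\<bar> * \<bar>w $ i\<bar> = \<bar>(A *v w) $ i\<bar>" by (simp add: w(2) abs_mult)
  also have "\<dots> \<le> (\<Sum>j\<in>UNIV. A $ i $ j * \<bar>w $ j\<bar>)"
    unfolding matrix_vector_mult_def using nonneg
    by (auto intro!: order_trans[OF sum_abs] sum_mono simp: abs_mult)
  also have "\<dots> \<le> (\<Sum>j\<in>UNIV. A $ i $ j * (M * z $ j))"
    using bound nonneg by (intro sum_mono mult_left_mono)
  also have "\<dots> = M * (A *v z) $ i"
    by (simp add: matrix_vector_mult_def sum_distrib_left mult_ac)
  also have "\<dots> \<le> M * (k * z $ i)" using super M by (intro mult_left_mono) auto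
  also have "\<dots> = k * \<bar>w $ i\<bar>" by (simp add: wi)
  finally have "\<bar>l\<bar> \<le> k" using wi M z[of i] by simp
  then show ?thesis by simp
qed

text \<open>
  The matching lower bound holds for the eigenvalue of a positive eigenvector only: here \<open>z\<close> is
  compared with that eigenvector.
\<close>
lemma subsolution_le_eigenvalue:
  fixes A :: "real ^ 'n::finite ^ 'n"
  assumes nonneg: "\<And>i j. 0 \<le> A $ i $ j" and v: "\<And>i. 0 < v $ i" "A *v v = r *s v"
    and z: "\<And>i. 0 < z $ i" and sub: "\<And>i. k * z $ i \<le> (A *v z) $ i"
  shows "k \<le> r"
proof -
  define q where "q = (\<lambda>i. z $ i / v $ i)"
  define M where "M = Max (range q)"
  have q_le: "q i \<le> M" for i unfolding M_def by (rule Max_ge) auto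
  have "M \<in> range q" unfolding M_def by (rule Max_in) auto
  then obtain i where i: "q i = M" by auto
  have bound: "z $ j \<le> M * v $ j" for j
    using q_le[of j] v(1)[of j] by (simp add: q_def field_simps)
  have zi: "z $ i = M * v $ i"
    using i v(1)[of i] by (auto simp: q_def field_simps)
  have "k * z $ i \<le> (\<Sum>j\<in>UNIV. A $ i $ j * z $ j)"
    using sub[of i] by (simp add: matrix_vector_mult_def)
  also have "\<dots> \<le> (\<Sum>j\<in>UNIV. A $ i $ j * (M * v $ j))"
    using bound nonneg by (intro sum_mono mult_left_mono)
  also have "\<dots> = M * (A *v v) $ i"
    by (simp add: matrix_vector_mult_def sum_distrib_left mult_ac)
  also have "\<dots> = r * z $ i" by (simp add: v(2) zi)
  finally show ?thesis using z[of i] by simp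
qed

lemma greatest_eigenvalue_eqI:
  fixes A :: "real ^ 'n::finite ^ 'n"
  assumes nonneg: "\<And>i j. 0 \<le> A $ i $ j" and v: "\<And>i. 0 < v $ i" "A *v v = r *s v"
  shows "(GREATEST l. real_eigenvalue A l) = r"
proof (rule Greatest_equality)
  have "v \<noteq> 0" using v(1)[of undefined] by auto
  then show "real_eigenvalue A r" using v(2) by (auto simp: real_eigenvalue_def)
  show "l \<le> r" if "real_eigenvalue A l" for l
    using nonneg v(1) _ that
    by (rule eigenvalue_le_supersolution) (simp add: v(2))
qed

section \<open>The spectral radius of the moment matrices\<close>

text \<open>
  The moment matrices depend on the laws of the \<open>\<xi> i j\<close> only, so their spectral theory is
  developed without the tree.
\<close>
locale label_family = prob_space N
  for N :: "'v measure" +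
  fixes \<xi> :: "'c::finite \<Rightarrow> 'c \<Rightarrow> 'v \<Rightarrow> real"
  assumes label_meas [measurable]: "\<And>i j. \<xi> i j \<in> borel_measurable N"
    and label_pos: "\<And>i j. AE x in N. 0 < \<xi> i j x"
begin

lemma moment_matrix_nth: "moment_matrix N \<xi> s $ i $ j = (\<integral>x. \<xi> i j x powr s \<partial>N)"
  by (simp add: moment_matrix_def)

lemma moment_integrable: "s \<in> moment_domain N \<xi> \<Longrightarrow> integrable N (\<lambda>x. \<xi> i j x powr s)"
  by (simp add: moment_domain_def)

lemma moment_pos:
  assumes "s \<in> moment_domain N \<xi>"
  shows "0 < moment_matrix N \<xi> s $ i $ j"
proof -
  have "(\<integral>x. \<xi> i j x powr s \<partial>N) \<noteq> 0"
  proof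
    assume "(\<integral>x. \<xi> i j x powr s \<partial>N) = 0"
    then have "AE x in N. \<xi> i j x powr s = 0"
      using integral_nonneg_eq_0_iff_AE[OF moment_integrable[OF assms]] by simp
    with label_pos[of i j] have "AE x in N. False" by eventually_elim simp
    then show False by simp
  qed
  moreover have "0 \<le> (\<integral>x. \<xi> i j x powr s \<partial>N)" by (rule Bochner_Integration.integral_nonneg) simp
  ultimately show ?thesis unfolding moment_matrix_nth by linarith
qed

lemma perron_moment_matrix:
  assumes s: "s \<in> moment_domain N \<xi>"
  obtains v where "\<And>i. 0 < v $ i" "moment_matrix N \<xi> s *v v = rho N \<xi> s *s v" "0 < rho N \<xi> s"
proof -
  obtain v r where v: "\<And>i. 0 < v $ i" "0 < r" "moment_matrix N \<xi> s *v v = r *s v"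
    using perron_eigenvector moment_pos[OF s] by blast
  have "rho N \<xi> s = r"
    unfolding rho_def by (rule greatest_eigenvalue_eqI[OF _ v(1,3)]) (rule less_imp_le[OF moment_pos[OF s]])
  then show thesis using that v by blast
qed

lemma rho_pos: "s \<in> moment_domain N \<xi> \<Longrightarrow> 0 < rho N \<xi> s"
  using perron_moment_matrix by metis

lemma rho_le:
  assumes s: "s \<in> moment_domain N \<xi>" and z: "\<And>i. 0 < z $ i"
    and "\<And>i. (moment_matrix N \<xi> s *v z) $ i \<le> k * z $ i"
  shows "rho N \<xi> s \<le> k"
proof -
  obtain v where v: "\<And>i. 0 < v $ i" "moment_matrix N \<xi> s *v v = rho N \<xi> s *s v"
    using perron_moment_matrix[OF s] by blast
  have "v \<noteq> 0" using v(1)[of undefined] by auto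
  then have "real_eigenvalue (moment_matrix N \<xi> s) (rho N \<xi> s)"
    using v(2) by (auto simp: real_eigenvalue_def)
  then show ?thesis
    using eigenvalue_le_supersolution[OF less_imp_le[OF moment_pos[OF s]]] assms by blast
qed

lemma le_rho:
  assumes s: "s \<in> moment_domain N \<xi>" and z: "\<And>i. 0 < z $ i"
    and "\<And>i. k * z $ i \<le> (moment_matrix N \<xi> s *v z) $ i"
  shows "k \<le> rho N \<xi> s"
proof -
  obtain v where v: "\<And>i. 0 < v $ i" "moment_matrix N \<xi> s *v v = rho N \<xi> s *s v"
    using perron_moment_matrix[OF s] by blast
  show ?thesis
    using subsolution_le_eigenvalue[OF less_imp_le[OF moment_pos[OF s]] v] assms by blast
qed

lemma zero_in_moment_domain: "0 \<in> moment_domain N \<xi>"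
proof -
  have "integrable N (\<lambda>x. \<xi> i j x powr 0)" for i j
    by (rule integrable_const_bound[where B = 1]) auto
  then show ?thesis by (simp add: moment_domain_def)
qed

lemma moment_matrix_0: "moment_matrix N \<xi> 0 $ i $ j = 1"
proof -
  have "(\<integral>x. \<xi> i j x powr 0 \<partial>N) = (\<integral>x. 1 \<partial>N)"
    using label_pos[of i j] by (intro integral_cong_AE) auto
  then show ?thesis by (simp add: moment_matrix_nth prob_space)
qed

lemma rho_0: "rho N \<xi> 0 = real CARD('c)"
proof (rule antisym)
  show "rho N \<xi> 0 \<le> real CARD('c)"
    by (rule rho_le[OF zero_in_moment_domain, of "\<chi> i. 1"])
      (auto simp: matrix_vector_mult_def moment_matrix_0)
  show "real CARD('c) \<le> rho N \<xi> 0"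
    by (rule le_rho[OF zero_in_moment_domain, of "\<chi> i. 1"])
      (auto simp: matrix_vector_mult_def moment_matrix_0)
qed

lemma moment_domain_between:
  assumes "a \<in> moment_domain N \<xi>" "b \<in> moment_domain N \<xi>" "a \<le> s" "s \<le> b"
  shows "s \<in> moment_domain N \<xi>"
proof -
  have "integrable N (\<lambda>x. \<xi> i j x powr s)" for i j
  proof (rule Bochner_Integration.integrable_bound)
    show "integrable N (\<lambda>x. \<xi> i j x powr a + \<xi> i j x powr b)"
      using assms by (auto simp: moment_integrable)
    show "AE x in N. norm (\<xi> i j x powr s) \<le> norm (\<xi> i j x powr a + \<xi> i j x powr b)"
      using label_pos[of i j]
    proof eventually_elim
      case (elim x)
      show ?case
      proof (cases "1 \<le> \<xi> i j x")
        case True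
        then have "\<xi> i j x powr s \<le> \<xi> i j x powr b" using assms by (intro powr_mono) auto
        then show ?thesis by (simp add: add_increasing)
      next
        case False
        then have "\<xi> i j x powr s \<le> \<xi> i j x powr a"
          using assms elim by (intro powr_mono') auto
        then show ?thesis by (simp add: add_increasing2)
      qed
    qed
  qed simp
  then show ?thesis by (simp add: moment_domain_def)
qed

text \<open>
  If \<open>v\<close> and \<open>w\<close> are Perron eigenvectors at \<open>x\<close> and \<open>y\<close>, then \<open>v\<^sup>a w\<^sup>b\<close> is a supersolution at
  \<open>a x + b y\<close> with the factor \<open>\<rho>(x)\<^sup>a \<rho>(y)\<^sup>b\<close>. Young's inequality is applied pointwise to the
  normalised quantities \<open>\<xi>\<^sub>i\<^sub>j\<^sup>x v\<^sub>j / (\<rho>(x) v\<^sub>i)\<close> and \<open>\<xi>\<^sub>i\<^sub>j\<^sup>y w\<^sub>j / (\<rho>(y) w\<^sub>i)\<close>, whose expectations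
  sum to \<open>1\<close> over \<open>j\<close>.
\<close>
lemma rho_log_convex_ineq:
  assumes x: "x \<in> moment_domain N \<xi>" and y: "y \<in> moment_domain N \<xi>"
    and ab: "0 \<le> a" "0 \<le> b" "a + b = 1" and D: "a * x + b * y \<in> moment_domain N \<xi>"
  shows "rho N \<xi> (a * x + b * y) \<le> rho N \<xi> x powr a * rho N \<xi> y powr b"
proof -
  obtain v where v: "\<And>i. 0 < v $ i" "moment_matrix N \<xi> x *v v = rho N \<xi> x *s v"
    and rx: "0 < rho N \<xi> x" using perron_moment_matrix[OF x] by blast
  obtain w where w: "\<And>i. 0 < w $ i" "moment_matrix N \<xi> y *v w = rho N \<xi> y *s w"
    and ry: "0 < rho N \<xi> y" using perron_moment_matrix[OF y] by blast
  define z :: "real ^ 'c" where "z = (\<chi> i. v $ i powr a * w $ i powr b)"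
  define \<kappa> where "\<kappa> = rho N \<xi> x powr a * rho N \<xi> y powr b"
  have z: "0 < z $ i" for i using v(1)[of i] w(1)[of i] by (simp add: z_def)
  have \<kappa>: "0 < \<kappa>" using rx ry by (simp add: \<kappa>_def)
  have "(moment_matrix N \<xi> (a * x + b * y) *v z) $ i \<le> \<kappa> * z $ i" for i
  proof -
    let ?v = "\<lambda>j. v $ j / (rho N \<xi> x * v $ i)" and ?w = "\<lambda>j. w $ j / (rho N \<xi> y * w $ i)"
    have sum_v: "(\<Sum>j\<in>UNIV. moment_matrix N \<xi> x $ i $ j * ?v j) = 1"
    proof -
      have "(\<Sum>j\<in>UNIV. moment_matrix N \<xi> x $ i $ j * ?v j)
          = (moment_matrix N \<xi> x *v v) $ i / (rho N \<xi> x * v $ i)"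
        by (simp add: matrix_vector_mult_def sum_divide_distrib)
      then show ?thesis using v(1)[of i] rx by (simp add: v(2))
    qed
    have sum_w: "(\<Sum>j\<in>UNIV. moment_matrix N \<xi> y $ i $ j * ?w j) = 1"
    proof -
      have "(\<Sum>j\<in>UNIV. moment_matrix N \<xi> y $ i $ j * ?w j)
          = (moment_matrix N \<xi> y *v w) $ i / (rho N \<xi> y * w $ i)"
        by (simp add: matrix_vector_mult_def sum_divide_distrib)
      then show ?thesis using w(1)[of i] ry by (simp add: w(2))
    qed
    have term_le: "moment_matrix N \<xi> (a * x + b * y) $ i $ j * z $ j
        \<le> \<kappa> * z $ i * (a * (moment_matrix N \<xi> x $ i $ j * ?v j) + b * (moment_matrix N \<xi> y $ i $ j * ?w j))"
      for j
    proof -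
      have "(\<integral>\<omega>. \<xi> i j \<omega> powr (a * x + b * y) * z $ j \<partial>N)
          \<le> (\<integral>\<omega>. \<kappa> * z $ i * (a * (\<xi> i j \<omega> powr x * ?v j) + b * (\<xi> i j \<omega> powr y * ?w j)) \<partial>N)"
      proof (rule integral_mono_AE)
        show "AE \<omega> in N. \<xi> i j \<omega> powr (a * x + b * y) * z $ j
          \<le> \<kappa> * z $ i * (a * (\<xi> i j \<omega> powr x * ?v j) + b * (\<xi> i j \<omega> powr y * ?w j))"
          using label_pos[of i j]
        proof eventually_elim
          case (elim \<omega>)
          let ?p = "\<xi> i j \<omega> powr x * ?v j" and ?q = "\<xi> i j \<omega> powr y * ?w j"
          have "?p powr a * ?q powr b \<le> a * ?p + b * ?q"
            using elim v(1) w(1) rx ry ab by (intro Youngs_inequality_0) auto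
          moreover have "?p powr a * ?q powr b = \<xi> i j \<omega> powr (a * x + b * y) * z $ j / (\<kappa> * z $ i)"
            using elim v(1)[of i] w(1)[of i] v(1)[of j] w(1)[of j] rx ry
            by (simp add: powr_mult powr_divide powr_powr powr_add z_def \<kappa>_def mult_ac)
          ultimately show ?case
            using z[of i] \<kappa> by (simp add: divide_le_eq mult_ac)
        qed
      qed (intro integrable_mult_right integrable_mult_left Bochner_Integration.integrable_add
          moment_integrable x y D)+
      then show ?thesis
        by (simp add: moment_matrix_nth moment_integrable x y D)
    qed
    have "(moment_matrix N \<xi> (a * x + b * y) *v z) $ i
        \<le> (\<Sum>j\<in>UNIV. \<kappa> * z $ i * (a * (moment_matrix N \<xi> x $ i $ j * ?v j) + b * (moment_matrix N \<xi> y $ i $ j * ?w j)))"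
      unfolding matrix_vector_mult_def using term_le by (auto intro!: sum_mono)
    also have "\<dots> = \<kappa> * z $ i * (a * (\<Sum>j\<in>UNIV. moment_matrix N \<xi> x $ i $ j * ?v j) + b * (\<Sum>j\<in>UNIV. moment_matrix N \<xi> y $ i $ j * ?w j))"
      by (simp only: sum_distrib_left[symmetric] sum.distrib)
    also have "\<dots> = \<kappa> * z $ i" by (simp only: sum_v sum_w) (simp add: ab)
    finally show ?thesis .
  qed
  then show ?thesis using rho_le[OF D z] by (simp add: \<kappa>_def)
qed

lemma ln_rho_convex:
  assumes "convex T" "T \<subseteq> moment_domain N \<xi>"
  shows "convex_on T (\<lambda>s. ln (rho N \<xi> s))"
  unfolding convex_on_def
proof (intro conjI ballI allI impI)
  fix x y a b :: real
  assume xy: "x \<in> T" "y \<in> T" and ab: "0 \<le> a" "0 \<le> b" "a + b = 1"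
  have D: "a * x + b * y \<in> moment_domain N \<xi>"
    using convexD[OF assms(1) xy ab] assms(2) by auto
  have xy': "x \<in> moment_domain N \<xi>" "y \<in> moment_domain N \<xi>" using xy assms by auto
  have "ln (rho N \<xi> (a * x + b * y)) \<le> ln (rho N \<xi> x powr a * rho N \<xi> y powr b)"
    using rho_log_convex_ineq[OF xy' ab D] rho_pos[OF D] by (subst ln_le_cancel_iff) auto
  also have "\<dots> = a * ln (rho N \<xi> x) + b * ln (rho N \<xi> y)"
    using xy'[THEN rho_pos] by (simp add: ln_mult ln_powr)
  finally show "ln (rho N \<xi> (a *\<^sub>R x + b *\<^sub>R y)) \<le> a * ln (rho N \<xi> x) + b * ln (rho N \<xi> y)"
    by simp
qed fact

text \<open>
  Dominated convergence for the difference quotients \<open>(\<xi>\<^sup>h - 1)/h\<close>. By convexity of the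
  exponential they are monotone in \<open>h\<close>, hence controlled by \<open>\<bar>ln \<xi>\<bar>\<close> and by the
  quotients at \<open>\<plusminus>e\<close>.
\<close>
lemma moment_has_derivative_at_0:
  assumes e: "0 < e" "-e \<in> moment_domain N \<xi>" "e \<in> moment_domain N \<xi>"
    and ln_int: "integrable N (\<lambda>x. \<bar>ln (\<xi> i j x)\<bar>)"
  shows "((\<lambda>s. moment_matrix N \<xi> s $ i $ j) has_real_derivative (\<integral>x. ln (\<xi> i j x) \<partial>N)) (at 0)"
proof -
  have dom: "h \<in> moment_domain N \<xi>" if "h \<in> {-e..e}" for h
    using moment_domain_between[OF e(2,3)] that by simp
  let ?q = "\<lambda>h x. (\<xi> i j x powr h - 1) / h"
  have bound: "AE x in N. norm (?q h x) \<le> \<bar>ln (\<xi> i j x)\<bar> + (\<xi> i j x powr e + \<xi> i j x powr (-e)) / e"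
    if h: "h \<in> {-e..e}" "h \<noteq> 0" for h
    using label_pos[of i j]
  proof eventually_elim
    case (elim x)
    let ?L = "ln (\<xi> i j x)"
    (* Negative h reduces to this case on replacing L by -L. *)
    have above: "(exp (h * L) - 1) / h \<le> exp (e * L) / e \<and> L \<le> (exp (h * L) - 1) / h"
      if "0 < h" "h \<le> e" for h L
    proof -
      have "exp ((1 - h / e) *\<^sub>R 0 + (h / e) *\<^sub>R (e * L)) \<le> (1 - h / e) * exp 0 + (h / e) * exp (e * L)"
        using that e by (intro convex_onD[OF exp_convex]) auto
      then have "exp (h * L) \<le> 1 + (h / e) * exp (e * L) - h / e" using e by simp
      moreover have "0 \<le> h / e" using that e by simp
      ultimately have "exp (h * L) - 1 \<le> h * (exp (e * L) / e)" by simp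
      moreover have "h * L \<le> exp (h * L) - 1" using exp_ge_add_one_self[of "h * L"] by linarith
      ultimately show ?thesis using that by (simp add: field_simps)
    qed
    have pos: "0 \<le> exp (e * ?L) / e" "0 \<le> exp (e * - ?L) / e" using e by auto
    have q: "?q h x = (exp (h * ?L) - 1) / h" using elim by (simp add: powr_def)
    have "\<bar>(exp (h * ?L) - 1) / h\<bar> \<le> \<bar>?L\<bar> + (exp (e * ?L) / e + exp (e * - ?L) / e)"
    proof (cases "0 < h")
      case True
      then show ?thesis using above[OF True, of ?L] h pos unfolding atLeastAtMost_iff by linarith
    next
      case False
      then have "0 < -h" "-h \<le> e" using h by auto
      from above[OF this, of "- ?L"]
      have "- ((exp (h * ?L) - 1) / h) \<le> exp (e * - ?L) / e \<and> - ?L \<le> - ((exp (h * ?L) - 1) / h)"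
        by simp
      then show ?thesis using pos by linarith
    qed
    then show ?case unfolding q using elim by (simp add: powr_def add_divide_distrib)
  qed
  have "((\<lambda>h. \<integral>x. ?q h x \<partial>N) \<longlongrightarrow> (\<integral>x. ln (\<xi> i j x) \<partial>N)) (at 0 within {-e..e})"
    unfolding tendsto_at_iff_sequentially comp_def
  proof (intro allI impI)
    fix X :: "nat \<Rightarrow> real"
    assume X: "\<forall>n. X n \<in> {-e..e} - {0}" "X \<longlonglongrightarrow> 0"
    show "(\<lambda>n. \<integral>x. ?q (X n) x \<partial>N) \<longlonglongrightarrow> (\<integral>x. ln (\<xi> i j x) \<partial>N)"
    proof (rule integral_dominated_convergence)
      show "integrable N (\<lambda>x. \<bar>ln (\<xi> i j x)\<bar> + (\<xi> i j x powr e + \<xi> i j x powr (-e)) / e)"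
        using ln_int e by (auto intro!: Bochner_Integration.integrable_add moment_integrable)
      show "AE x in N. norm (?q (X n) x) \<le> \<bar>ln (\<xi> i j x)\<bar> + (\<xi> i j x powr e + \<xi> i j x powr (-e)) / e" for n
        using X(1) by (intro bound) auto
      show "AE x in N. (\<lambda>n. ?q (X n) x) \<longlonglongrightarrow> ln (\<xi> i j x)"
        using label_pos[of i j]
      proof eventually_elim
        case (elim x)
        have "((\<lambda>h. \<xi> i j x powr h) has_real_derivative ln (\<xi> i j x)) (at 0)"
          using elim by (auto intro!: derivative_eq_intros)
        then have "((\<lambda>h. ?q h x) \<longlongrightarrow> ln (\<xi> i j x)) (at 0)"
          using elim by (simp add: DERIV_def)
        then show ?case
          using X unfolding tendsto_at_iff_sequentially comp_def by auto
      qed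
    qed simp_all
  qed
  moreover have "eventually (\<lambda>h. (\<integral>x. ?q h x \<partial>N)
      = (moment_matrix N \<xi> h $ i $ j - moment_matrix N \<xi> 0 $ i $ j) / h) (at 0 within {-e..e})"
    unfolding eventually_at_filter
    by (intro always_eventually allI impI)
      (simp add: moment_matrix_0, simp add: moment_matrix_nth moment_integrable dom prob_space)
  ultimately have "((\<lambda>h. (moment_matrix N \<xi> h $ i $ j - moment_matrix N \<xi> 0 $ i $ j) / h)
      \<longlongrightarrow> (\<integral>x. ln (\<xi> i j x) \<partial>N)) (at 0 within {-e..e})"
    using tendsto_cong by fast
  moreover have "at 0 within {-e..e} = at 0"
    using e by (intro at_within_interior) auto
  ultimately show ?thesis by (simp add: DERIV_def)
qed

text \<open>
  At \<open>s = 0\<close> all entries of the moment matrix are \<open>1\<close>, with Perron eigenvector \<open>(1, \<dots>, 1)\<close>. The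
  trial vectors \<open>z(s)\<close> follow the Perron eigenvector to first order, so all the quotients
  \<open>(m(s) z(s))\<^sub>i / z(s)\<^sub>i\<close> have the same value \<open>\<rho>(0)\<close> and the same derivative \<open>\<beta>\<close> at \<open>0\<close>. Since \<open>\<rho>(s)\<close> lies between the
  smallest and the largest of them, it inherits that derivative.
\<close>
lemma rho_differentiable_at_0:
  assumes e: "0 < e" "-e \<in> moment_domain N \<xi>" "e \<in> moment_domain N \<xi>"
    and ln_int: "\<And>i j. integrable N (\<lambda>x. \<bar>ln (\<xi> i j x)\<bar>)"
  obtains D where "(rho N \<xi> has_real_derivative D) (at 0)"
proof -
  define d where "d = real CARD('c)"
  have d: "0 < d" by (simp add: d_def)
  define b where "b = (\<lambda>i. \<Sum>j\<in>UNIV. \<integral>x. ln (\<xi> i j x) \<partial>N)"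
  define \<beta> where "\<beta> = (\<Sum>j\<in>UNIV. b j) / d"
  (* The correction b i / d is the one that makes Q' below independent of i. *)
  define z where "z = (\<lambda>s. \<chi> i. 1 + s * b i / d)"
  define Q where "Q = (\<lambda>i s. (moment_matrix N \<xi> s *v z s) $ i / z s $ i)"
  have Q0: "Q i 0 = rho N \<xi> 0" for i
    by (simp add: Q_def z_def matrix_vector_mult_def moment_matrix_0 rho_0)
  have Q': "(Q i has_real_derivative \<beta>) (at 0)" for i
  proof -
    have z': "((\<lambda>s. z s $ i) has_real_derivative b i / d) (at 0)" for i
      unfolding z_def using d by (auto intro!: derivative_eq_intros)
    have z0: "z 0 $ i = 1" for i by (simp add: z_def)
    have "((\<lambda>s. \<Sum>j\<in>UNIV. moment_matrix N \<xi> s $ i $ j * z s $ j) has_real_derivative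
        (\<Sum>j\<in>UNIV. (\<integral>x. ln (\<xi> i j x) \<partial>N) * z 0 $ j + b j / d * moment_matrix N \<xi> 0 $ i $ j)) (at 0)"
      by (intro DERIV_sum DERIV_mult moment_has_derivative_at_0[OF e ln_int] z')
    also have "(\<Sum>j\<in>UNIV. (\<integral>x. ln (\<xi> i j x) \<partial>N) * z 0 $ j + b j / d * moment_matrix N \<xi> 0 $ i $ j) = b i + \<beta>"
      by (simp add: z0 moment_matrix_0 sum.distrib b_def \<beta>_def sum_divide_distrib)
    finally have "((\<lambda>s. (\<Sum>j\<in>UNIV. moment_matrix N \<xi> s $ i $ j * z s $ j) / z s $ i) has_real_derivative
        ((b i + \<beta>) * z 0 $ i - (\<Sum>j\<in>UNIV. moment_matrix N \<xi> 0 $ i $ j * z 0 $ j) * (b i / d))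
          / (z 0 $ i * z 0 $ i)) (at 0)"
      using z' by (rule DERIV_divide) (simp add: z0)
    then show ?thesis
      unfolding Q_def matrix_vector_mult_def using d
      by (simp add: z0 moment_matrix_0 d_def[symmetric])
  qed
  have "(\<lambda>s. (rho N \<xi> s - rho N \<xi> 0) / s - \<beta>) \<midarrow>0\<rightarrow> 0"
  proof (rule Lim_null_comparison)
    have "(\<lambda>s. \<Sum>i\<in>UNIV. \<bar>(Q i s - Q i 0) / s - \<beta>\<bar>) \<midarrow>0\<rightarrow> (\<Sum>i\<in>(UNIV::'c set). \<bar>\<beta> - \<beta>\<bar>)"
      using Q' by (intro tendsto_intros) (simp add: DERIV_def)
    then show "(\<lambda>s. \<Sum>i\<in>UNIV. \<bar>(Q i s - Q i 0) / s - \<beta>\<bar>) \<midarrow>0\<rightarrow> 0" by simp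
    have "eventually (\<lambda>s. 0 < z s $ i) (at 0)" for i
    proof -
      have "(\<lambda>s. z s $ i) \<midarrow>0\<rightarrow> 1 + 0 * b i / d"
        unfolding z_def by (auto intro!: tendsto_eq_intros simp: d less_imp_neq[symmetric])
      then show ?thesis by (rule order_tendstoD) simp
    qed
    then have "eventually (\<lambda>s. \<forall>i. 0 < z s $ i) (at 0)"
      by (rule eventually_all_finite)
    moreover have "eventually (\<lambda>s. s \<in> {-e<..<e}) (at 0)"
      using e by (intro eventually_at_in_open') auto
    ultimately show "eventually (\<lambda>s. norm ((rho N \<xi> s - rho N \<xi> 0) / s - \<beta>)
        \<le> (\<Sum>i\<in>UNIV. \<bar>(Q i s - Q i 0) / s - \<beta>\<bar>)) (at 0)"
      using eventually_neq_at_within[of 0]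
    proof eventually_elim
      case (elim s)
      have D: "s \<in> moment_domain N \<xi>" using moment_domain_between[OF e(2,3)] elim by simp
      define K where "K = (\<Sum>i\<in>UNIV. \<bar>Q i s - (rho N \<xi> 0 + s * \<beta>)\<bar>)"
      have K: "\<bar>Q i s - (rho N \<xi> 0 + s * \<beta>)\<bar> \<le> K" for i
        unfolding K_def by (rule member_le_sum) auto
      have Qz: "(moment_matrix N \<xi> s *v z s) $ i = Q i s * z s $ i" for i
        using elim(1) by (simp add: Q_def less_imp_neq[symmetric])
      have "rho N \<xi> s \<le> rho N \<xi> 0 + s * \<beta> + K"
      proof (rule rho_le[OF D])
        show z: "0 < z s $ i" for i using elim(1) by simp
        have "Q i s \<le> rho N \<xi> 0 + s * \<beta> + K" for i using K[of i] by linarith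
        then show "(moment_matrix N \<xi> s *v z s) $ i \<le> (rho N \<xi> 0 + s * \<beta> + K) * z s $ i" for i
          unfolding Qz by (rule mult_right_mono) (rule less_imp_le[OF z])
      qed
      moreover have "rho N \<xi> 0 + s * \<beta> - K \<le> rho N \<xi> s"
      proof (rule le_rho[OF D])
        show z: "0 < z s $ i" for i using elim(1) by simp
        have "rho N \<xi> 0 + s * \<beta> - K \<le> Q i s" for i using K[of i] by linarith
        then show "(rho N \<xi> 0 + s * \<beta> - K) * z s $ i \<le> (moment_matrix N \<xi> s *v z s) $ i" for i
          unfolding Qz by (rule mult_right_mono) (rule less_imp_le[OF z])
      qed
      ultimately have "\<bar>rho N \<xi> s - (rho N \<xi> 0 + s * \<beta>)\<bar> / \<bar>s\<bar> \<le> K / \<bar>s\<bar>"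
        by (intro divide_right_mono) auto
      moreover have "\<bar>(q - r) / s - \<beta>\<bar> = \<bar>q - (r + s * \<beta>)\<bar> / \<bar>s\<bar>" for q r
        using elim(3) by (simp add: diff_divide_distrib flip: abs_divide) (simp add: field_simps)
      ultimately show ?case by (simp add: K_def sum_divide_distrib Q0)
    qed
  qed
  then have "(rho N \<xi> has_real_derivative \<beta>) (at 0)"
    by (simp add: DERIV_def LIM_zero_iff)
  then show thesis by (rule that)
qed

end

section \<open>Zeros and slopes of convex functions\<close>

text \<open>
  The intermediate value theorem gives the zero, and the one-sided derivative of \<open>f\<close> there is
  a subgradient \<open>-k\<close>. Evaluating the subgradient inequality at \<open>0\<close> and comparing it with the
  tangent of \<open>f\<close> at \<open>0\<close>, evaluated at \<open>\<alpha>\<close>, gives \<open>k \<le> \<mu>\<close>.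
\<close>
lemma convex_zero_slope:
  fixes f :: "real \<Rightarrow> real"
  assumes e: "0 < e" and conv: "convex_on {-e<..} f"
    and deriv: "(f has_real_derivative - \<mu>) (at 0)"
    and f0: "0 < f 0" and s0: "0 \<le> s0" "f s0 < 0"
  obtains \<alpha> k where "0 < \<alpha>" "f \<alpha> = 0" "\<alpha> < s0" "0 < k" "k \<le> \<mu>"
    "\<forall>s>-e. k * (\<alpha> - s) \<le> f s"
proof -
  have "continuous_on {-e<..} f" using conv by (intro convex_on_continuous) auto
  then have "continuous_on {0..s0} f" by (rule continuous_on_subset) (use e in auto)
  then obtain \<alpha> where \<alpha>: "0 \<le> \<alpha>" "\<alpha> \<le> s0" "f \<alpha> = 0"
    using IVT2'[of f s0 0 0] f0 s0 by auto
  with f0 s0 have \<alpha>': "0 < \<alpha>" "\<alpha> < s0" by (auto simp: less_le)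
  define k where "k = - Inf ((\<lambda>t. (f \<alpha> - f t) / (\<alpha> - t)) ` ({\<alpha><..} \<inter> {-e<..}))"
  have k: "k * (\<alpha> - s) \<le> f s" if "-e < s" for s
    using convex_le_Inf_differential[OF conv, of \<alpha> s] that \<alpha> e
    by (auto simp: k_def interior_open algebra_simps)
  have "k * (\<alpha> - s0) < 0" using k[of s0] s0 e by linarith
  then have "0 < k" using \<alpha>' by (simp add: mult_less_0_iff)
  moreover have "k \<le> \<mu>"
  proof -
    have "f \<alpha> - f 0 \<ge> - \<mu> * (\<alpha> - 0)"
      using e \<alpha>' by (intro convex_on_imp_above_tangent[OF conv])
        (auto simp: interior_open intro!: has_field_derivative_at_within deriv)
    then have "k * \<alpha> \<le> \<mu> * \<alpha>" using k[of 0] e \<alpha> by auto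
    then show ?thesis using \<alpha>' by simp
  qed
  ultimately show thesis using that \<alpha> \<alpha>' k by blast
qed

lemma convex_negative_right_of_zero:
  fixes f :: "real \<Rightarrow> real"
  assumes conv: "convex_on S f" and "\<alpha> \<in> S" "f \<alpha> = 0" and s0: "s0 \<in> S" "f s0 < 0" "\<alpha> < s0"
    and s: "\<alpha> < s" "s < s0"
  shows "f s < 0"
proof -
  have "(f \<alpha> - f s) / (\<alpha> - s) \<le> (f \<alpha> - f s0) / (\<alpha> - s0)"
    using assms by (intro convex_on_slope_le(1)[OF conv]) auto
  also have "\<dots> < 0" using assms by (simp add: zero_less_divide_iff divide_less_0_iff)
  finally show ?thesis using assms by (simp add: zero_less_divide_iff divide_less_0_iff)
qed

text \<open>
  On the points \<open>s\<^sub>n = \<alpha> - \<alpha>/2\<^sup>n\<close> the chord slopes of \<open>-f\<close> decrease by convexity and are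
  bounded below by \<open>k\<close>, so they converge to some \<open>L > 0\<close>. For large \<open>n\<close> two consecutive slopes
  therefore lie strictly between \<open>a = (1 - \<eta>) L\<close> and \<open>b = (1 + \<eta>) L\<close>. All chords are taken
  to the left of \<open>\<alpha>\<close> because a convex function may have a corner at \<open>\<alpha>\<close> itself.
\<close>
lemma convex_almost_linear_left_of_zero:
  fixes f :: "real \<Rightarrow> real"
  assumes conv: "convex_on S f" and S: "{0..\<alpha>} \<subseteq> S"
    and \<alpha>: "0 < \<alpha>" "f \<alpha> = 0" and k: "0 < k" "\<And>s. s \<in> S \<Longrightarrow> k * (\<alpha> - s) \<le> f s"
    and \<epsilon>: "0 < \<epsilon>"
  obtains s1 s2 s3 a b where "0 \<le> s1" "s1 < s2" "s2 < s3" "0 < f s2" "0 < a" "0 < b"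
    "\<alpha> - \<epsilon> < s2 * a / b" "f s3 - f s2 < - (s3 - s2) * a" "f s1 - f s2 < (s2 - s1) * b"
proof -
  define s where "s = (\<lambda>n::nat. \<alpha> - \<alpha> / 2 ^ n)"
  define \<sigma> where "\<sigma> = (\<lambda>n. (f (s n) - f (s (Suc n))) / (s (Suc n) - s n))"
  have s_less: "s n < s (Suc n)" for n using \<alpha> by (simp add: s_def field_simps)
  have s_\<alpha>: "s n < \<alpha>" for n using \<alpha> by (simp add: s_def)
  have s_0: "0 \<le> s n" for n using \<alpha> by (simp add: s_def field_simps)
  have s_S: "s n \<in> S" for n using s_\<alpha>[of n] s_0[of n] S by auto
  have \<sigma>_eq: "\<sigma> n = - ((f (s n) - f (s (Suc n))) / (s n - s (Suc n)))" for n
    unfolding \<sigma>_def by (metis minus_diff_eq minus_divide_right)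
  have "\<sigma> (Suc n) \<le> \<sigma> n" for n
    using convex_on_slope_le[OF conv s_S s_S s_less[of n] s_less[of "Suc n"]]
    unfolding \<sigma>_eq by linarith
  then have dec: "decseq \<sigma>" by (rule decseq_SucI)
  have k_le: "k \<le> \<sigma> n" for n
  proof -
    have "(f (s n) - f (s (Suc n))) / (s n - s (Suc n)) \<le> (f (s (Suc n)) - f \<alpha>) / (s (Suc n) - \<alpha>)"
      using convex_on_slope_le[OF conv s_S, of \<alpha> n "s (Suc n)"] s_less[of n] s_\<alpha>[of "Suc n"] S \<alpha>(1)
      by (meson atLeastAtMost_iff less_imp_le order_refl order_trans subsetD)
    also have "\<dots> \<le> - k"
      using k(2)[OF s_S[of "Suc n"]] s_\<alpha>[of "Suc n"] \<alpha>
      by (simp add: divide_le_eq algebra_simps)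
    finally show ?thesis unfolding \<sigma>_eq by linarith
  qed
  obtain L where L: "\<sigma> \<longlonglongrightarrow> L" "\<And>n. L \<le> \<sigma> n"
    using decseq_convergent[OF dec, of k] k_le by blast
  have "k \<le> L" using k_le L(1) by (intro LIMSEQ_le_const) auto
  then have L_pos: "0 < L" using k by linarith
  (* Chosen so that (1 - eta)^2 / (1 + eta) >= 1 - 4 eta yields the required alpha - epsilon. *)
  define \<eta> where "\<eta> = min (1/2) (\<epsilon> / (4 * \<alpha>))"
  have \<eta>: "0 < \<eta>" "\<eta> \<le> 1/2" "\<alpha> * \<eta> \<le> \<epsilon> / 4"
    using \<epsilon> \<alpha> by (auto simp: \<eta>_def min_def field_simps)
  have "s \<longlonglongrightarrow> \<alpha>"
  proof -
    have "s \<longlonglongrightarrow> \<alpha> - 0"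
      unfolding s_def by (intro tendsto_intros LIMSEQ_divide_realpow_zero) simp
    then show ?thesis by simp
  qed
  moreover have "(1 - \<eta>) * \<alpha> < \<alpha>" using \<eta> \<alpha> by simp
  ultimately have "eventually (\<lambda>n. (1 - \<eta>) * \<alpha> < s n) sequentially"
    by (rule order_tendstoD)
  moreover have "eventually (\<lambda>n. \<sigma> n < (1 + \<eta>) * L) sequentially"
    using L(1) L_pos \<eta> by (intro order_tendstoD(2)) auto
  ultimately have "eventually (\<lambda>n. (1 - \<eta>) * \<alpha> < s n \<and> \<sigma> n < (1 + \<eta>) * L) sequentially"
    by eventually_elim auto
  then obtain n where n: "(1 - \<eta>) * \<alpha> < s n" "\<sigma> n < (1 + \<eta>) * L"
    by (auto simp: eventually_sequentially)
  let ?a = "(1 - \<eta>) * L" and ?b = "(1 + \<eta>) * L"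
  show thesis
  proof (rule that[of "s n" "s (Suc n)" "s (Suc (Suc n))" ?a ?b])
    have "0 < k * (\<alpha> - s (Suc n))" using k(1) s_\<alpha>[of "Suc n"] by simp
    then show "0 < f (s (Suc n))" using k(2)[OF s_S[of "Suc n"]] by linarith
    show "0 < ?a" "0 < ?b" using \<eta> L_pos by auto
    have "(\<alpha> - \<epsilon>) * (1 + \<eta>) \<le> \<alpha> * ((1 - 4 * \<eta>) * (1 + \<eta>))"
    proof -
      have "\<alpha> - \<epsilon> \<le> \<alpha> * (1 - 4 * \<eta>)" using \<eta> by (simp add: algebra_simps)
      then show ?thesis using \<eta> by (simp add: mult_right_mono flip: mult.assoc)
    qed
    also have "\<dots> \<le> \<alpha> * ((1 - \<eta>) * (1 - \<eta>))"
      using \<alpha> \<eta> by (intro mult_left_mono) (auto simp: algebra_simps)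
    also have "\<dots> < s n * (1 - \<eta>)"
      using n(1) \<eta> by (simp add: mult_ac)
    also have "\<dots> < s (Suc n) * (1 - \<eta>)" using s_less[of n] \<eta> by simp
    finally have "\<alpha> - \<epsilon> < s (Suc n) * (1 - \<eta>) / (1 + \<eta>)"
      using \<eta> by (simp add: less_divide_eq)
    then show "\<alpha> - \<epsilon> < s (Suc n) * ?a / ?b"
      using L_pos by (simp flip: mult.assoc)
    have "?a < L" using L_pos \<eta> by (simp add: algebra_simps)
    then have "?a < \<sigma> (Suc n)" using L(2)[of "Suc n"] by linarith
    then show "f (s (Suc (Suc n))) - f (s (Suc n)) < - (s (Suc (Suc n)) - s (Suc n)) * ?a"
      using s_less[of "Suc n"] by (simp add: \<sigma>_def field_simps)
    show "f (s n) - f (s (Suc n)) < (s (Suc n) - s n) * ?b"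
      using n(2) s_less[of n] by (simp add: \<sigma>_def field_simps)
  qed (use s_0 s_less in auto)
qed

section \<open>The growth quotient\<close>

lemma growth_quotient_le:
  fixes \<xi> :: "'c::finite \<Rightarrow> 'c \<Rightarrow> 'v \<Rightarrow> real"
  assumes u: "0 < u" and s: "0 \<le> s"
  shows "growth_quotient N \<xi> u \<le> ereal (s + ln (rho N \<xi> s) / u)"
proof -
  have "ereal (s * (- u) - Lambda N \<xi> s) \<le> Lambda_star N \<xi> (- u)"
    unfolding Lambda_star_def using s by (intro SUP_upper) simp
  then have "ereal (ln (real CARD('c))) - Lambda_star N \<xi> (- u)
      \<le> ereal (ln (real CARD('c))) - ereal (s * (- u) - Lambda N \<xi> s)"
    by (intro ereal_minus_mono) auto
  also have "\<dots> = ereal (s * u + ln (rho N \<xi> s))" by (simp add: Lambda_def)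
  finally have "(ereal (ln (real CARD('c))) - Lambda_star N \<xi> (- u)) / ereal u
      \<le> ereal (s * u + ln (rho N \<xi> s)) / ereal u"
    using u by (intro ereal_divide_right_mono) auto
  also have "\<dots> = ereal (s + ln (rho N \<xi> s) / u)"
    using u by (simp add: add_divide_distrib)
  finally show ?thesis using u by (simp add: growth_quotient_def Let_def)
qed

lemma le_growth_quotient:
  fixes \<xi> :: "'c::finite \<Rightarrow> 'c \<Rightarrow> 'v \<Rightarrow> real"
  assumes u: "0 < u" and s: "\<And>s. 0 \<le> s \<Longrightarrow> u * (\<alpha> - s) \<le> ln (rho N \<xi> s)"
  shows "ereal \<alpha> \<le> growth_quotient N \<xi> u"
proof -
  have "Lambda_star N \<xi> (- u) \<le> ereal (ln (real CARD('c)) - u * \<alpha>)"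
    unfolding Lambda_star_def
  proof (rule SUP_least)
    fix s :: real assume "s \<in> {0..}"
    then show "ereal (s * (- u) - Lambda N \<xi> s) \<le> ereal (ln (real CARD('c)) - u * \<alpha>)"
      using s[of s] by (simp add: Lambda_def algebra_simps)
  qed
  then have "ereal (ln (real CARD('c))) - ereal (ln (real CARD('c)) - u * \<alpha>)
      \<le> ereal (ln (real CARD('c))) - Lambda_star N \<xi> (- u)"
    by (intro ereal_minus_mono) auto
  then have "ereal (u * \<alpha>) / ereal u \<le> (ereal (ln (real CARD('c))) - Lambda_star N \<xi> (- u)) / ereal u"
    using u by (intro ereal_divide_right_mono) auto
  then show ?thesis using u by (simp add: growth_quotient_def Let_def)
qed

text \<open>
  A single exponent \<open>s\<close> with \<open>\<rho>(s) < 1\<close> forces the limit at \<open>0\<close>, as \<open>s + ln \<rho>(s) / v\<close> tends to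
  \<open>-\<infinity>\<close> when \<open>v\<close> decreases to \<open>0\<close>.
\<close>
lemma growth_quotient_0:
  fixes \<xi> :: "'c::finite \<Rightarrow> 'c \<Rightarrow> 'v \<Rightarrow> real"
  assumes s: "0 \<le> s" "ln (rho N \<xi> s) < 0"
  shows "growth_quotient N \<xi> 0 = - \<infinity>"
proof -
  let ?q = "\<lambda>v. (ereal (ln (real CARD('c))) - Lambda_star N \<xi> (- v)) / ereal v"
  have "(?q \<longlongrightarrow> - \<infinity>) (at_right 0)"
    unfolding tendsto_MInfty
  proof
    fix r :: real
    have "filterlim (\<lambda>v. ln (rho N \<xi> s) * inverse v) at_bot (at_right 0)"
      using s(2) by (intro filterlim_tendsto_neg_mult_at_bot[OF tendsto_const] filterlim_inverse_at_top_right)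
    then have "eventually (\<lambda>v. ln (rho N \<xi> s) * inverse v < r - s) (at_right 0)"
      by (simp add: filterlim_at_bot_dense)
    then show "eventually (\<lambda>v. ?q v < ereal r) (at_right 0)"
      using eventually_at_right_less
    proof eventually_elim
      case (elim v)
      have "?q v = growth_quotient N \<xi> v" using elim(2) by (simp add: growth_quotient_def Let_def)
      also have "\<dots> \<le> ereal (s + ln (rho N \<xi> s) / v)" by (rule growth_quotient_le[OF elim(2) s(1)])
      also have "\<dots> < ereal r" using elim(1) by (simp add: divide_inverse)
      finally show ?case .
    qed
  qed
  then have "Lim (at_right 0) ?q = - \<infinity>" by (intro tendsto_Lim) simp_all
  then show ?thesis by (simp add: growth_quotient_def Let_def)
qed

section \<open>Weights of colour paths\<close>

text \<open>
  Summed over all lists of length \<open>n\<close>, these weights give the \<open>i\<close>-th coordinate of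
  \<open>m\<^sup>n (1, \<dots>, 1)\<close>.
\<close>
primrec path_weight :: "('c \<Rightarrow> 'c \<Rightarrow> real) \<Rightarrow> 'c \<Rightarrow> 'c list \<Rightarrow> real" where
  "path_weight m i [] = 1"
| "path_weight m i (j # js) = m i j * path_weight m j js"

lemma path_weight_eq_prod:
  "path_weight m i js = (\<Prod>k<length js. m ((i # js) ! k) (js ! k))"
proof (induction js arbitrary: i)
  case (Cons j js)
  have "(\<Prod>k<Suc (length js). m ((i # j # js) ! k) ((j # js) ! k))
      = m i j * (\<Prod>k<length js. m ((j # js) ! k) (js ! k))"
    unfolding prod.lessThan_Suc_shift by simp
  then show ?case using Cons.IH by simp
qed simp

text \<open>
  Composition with a transposition of two values shows that all values of \<open>f k\<close> are equally
  frequent among the bijections.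
\<close>
lemma card_bij_with_value:
  fixes k j :: "'c::finite"
  shows "card {f :: 'c \<Rightarrow> 'c. bij f \<and> f k = j} * CARD('c) = card {f :: 'c \<Rightarrow> 'c. bij f}"
proof -
  let ?B = "\<lambda>j. {f :: 'c \<Rightarrow> 'c. bij f \<and> f k = j}"
  have same: "card (?B j') = card (?B j)" for j'
  proof (rule bij_betw_same_card)
    let ?t = "\<lambda>f :: 'c \<Rightarrow> 'c. Transposition.transpose j j' \<circ> f"
    have inv: "?t (?t f) = f" for f by (simp add: fun_eq_iff)
    have bij: "bij (?t f)" if "bij f" for f
      using that by (rule bij_comp[OF _ bij_transpose])
    show "bij_betw ?t (?B j') (?B j)"
      by (rule bij_betw_byWitness[where f' = ?t]) (use inv bij in \<open>force+\<close>)
  qed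
  have "{f :: 'c \<Rightarrow> 'c. bij f} = (\<Union>j'. ?B j')" by auto
  also have "card \<dots> = (\<Sum>j'\<in>UNIV. card (?B j'))"
    by (rule card_UN_disjoint) auto
  also have "\<dots> = (\<Sum>j'\<in>(UNIV :: 'c set). card (?B j))"
    by (rule sum.cong[OF refl same])
  finally show ?thesis by simp
qed

lemma sets_Collect_finite_Ball:
  assumes "finite I" "\<And>i. i \<in> I \<Longrightarrow> {x \<in> space M. Q i x} \<in> sets M"
  shows "{x \<in> space M. \<forall>i\<in>I. Q i x} \<in> sets M"
proof (cases "I = {}")
  case False
  show ?thesis by (rule sets.sets_Collect_finite_All'[OF assms(2,1) False])
qed simp

lemma sum_path_weight_Suc:
  fixes m :: "'c::finite \<Rightarrow> 'c \<Rightarrow> real"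
  shows "(\<Sum>js | length js = Suc n. path_weight m i js) = (\<Sum>j\<in>UNIV. m i j * (\<Sum>js | length js = n. path_weight m j js))"
proof -
  have "(\<Sum>js | length js = Suc n. path_weight m i js)
      = (\<Sum>(j, js)\<in>UNIV \<times> {js. length js = n}. path_weight m i (j # js))"
    by (rule sum.reindex_bij_witness[of _ "\<lambda>(j, js). j # js" "\<lambda>js. (hd js, tl js)"])
      (auto simp: length_Suc_conv)
  also have "\<dots> = (\<Sum>j\<in>UNIV. m i j * (\<Sum>js | length js = n. path_weight m j js))"
    by (simp add: sum.cartesian_product[symmetric] sum_distrib_left)
  finally show ?thesis .
qed

lemma finite_length_eq: "finite {u :: 'c::finite list. length u = n}"
  using finite_lists_length_eq[of "UNIV :: 'c set" n] by simp

text \<open>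
  The vector \<open>(1, \<dots>, 1)\<close> lies between two multiples of the positive eigenvector \<open>v\<close>, and \<open>m\<close>
  preserves inequalities between vectors.
\<close>
lemma sum_path_weight_bounds:
  fixes m :: "'c::finite \<Rightarrow> 'c \<Rightarrow> real"
  assumes m: "\<And>i j. 0 < m i j" and v: "\<And>i. 0 < v i" and r: "0 < r"
    and eigen: "\<And>i. (\<Sum>j\<in>UNIV. m i j * v j) = r * v i"
  shows "\<exists>a b. 0 < a \<and> 0 < b \<and>
    (\<forall>n i. a * r ^ n \<le> (\<Sum>js | length js = n. path_weight m i js)) \<and>
    (\<forall>n i. (\<Sum>js | length js = n. path_weight m i js) \<le> b * r ^ n)"
proof -
  define lo hi where "lo = Min (range v)" and "hi = Max (range v)"
  have "lo \<in> range v" unfolding lo_def by (rule Min_in) auto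
  then have lo: "0 < lo" using v by auto
  have lo_hi: "lo \<le> v i" "v i \<le> hi" for i by (auto simp: lo_def hi_def)
  then have hi: "0 < hi" using v less_le_trans by blast
  have eigen_power: "v i * r ^ Suc n = (\<Sum>j\<in>UNIV. m i j * (v j * r ^ n))" for i n
  proof -
    have "v i * r ^ Suc n = (r * v i) * r ^ n" by simp
    then show ?thesis by (simp only: eigen[symmetric] sum_distrib_right mult.assoc)
  qed
  have lower: "v i * r ^ n \<le> hi * (\<Sum>js | length js = n. path_weight m i js)" for n i
  proof (induction n arbitrary: i)
    case 0
    then show ?case using lo_hi(2) by simp
  next
    case (Suc n)
    have "v i * r ^ Suc n = (\<Sum>j\<in>UNIV. m i j * (v j * r ^ n))"
      by (rule eigen_power)
    also have "\<dots> \<le> (\<Sum>j\<in>UNIV. m i j * (hi * (\<Sum>js | length js = n. path_weight m j js)))"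
      by (intro sum_mono mult_left_mono Suc.IH less_imp_le[OF m])
    also have "\<dots> = hi * (\<Sum>js | length js = Suc n. path_weight m i js)"
      by (simp add: sum_path_weight_Suc sum_distrib_left mult_ac)
    finally show ?case .
  qed
  have upper: "lo * (\<Sum>js | length js = n. path_weight m i js) \<le> v i * r ^ n" for n i
  proof (induction n arbitrary: i)
    case 0
    then show ?case using lo_hi(1) by simp
  next
    case (Suc n)
    have "lo * (\<Sum>js | length js = Suc n. path_weight m i js)
        = (\<Sum>j\<in>UNIV. m i j * (lo * (\<Sum>js | length js = n. path_weight m j js)))"
      by (simp add: sum_path_weight_Suc sum_distrib_left mult_ac)
    also have "\<dots> \<le> (\<Sum>j\<in>UNIV. m i j * (v j * r ^ n))"
      by (intro sum_mono mult_left_mono Suc.IH less_imp_le[OF m])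
    also have "\<dots> = v i * r ^ Suc n"
      by (rule eigen_power[symmetric])
    finally show ?case .
  qed
  show ?thesis
  proof (rule exI[of _ "lo / hi"], rule exI[of _ "hi / lo"], intro conjI allI)
    show "lo / hi * r ^ n \<le> (\<Sum>js | length js = n. path_weight m i js)" for n i
    proof -
      have "lo * r ^ n \<le> v i * r ^ n" using lo_hi(1) r by (intro mult_right_mono) auto
      with lower[where n = n and i = i] have "lo * r ^ n \<le> hi * (\<Sum>js | length js = n. path_weight m i js)" by linarith
      then show ?thesis using hi by (simp add: pos_divide_le_eq mult_ac)
    qed
    show "(\<Sum>js | length js = n. path_weight m i js) \<le> hi / lo * r ^ n" for n i
    proof -
      have "v i * r ^ n \<le> hi * r ^ n" using lo_hi(2) r by (intro mult_right_mono) auto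
      with upper[where n = n and i = i] have "lo * (\<Sum>js | length js = n. path_weight m i js) \<le> hi * r ^ n" by linarith
      then show ?thesis using lo by (simp add: pos_le_divide_eq mult_ac)
    qed
  qed (use lo hi in auto)
qed

section \<open>The joint law of the colours and labels along a path\<close>

context coloured_tree
begin

abbreviation F where "F \<equiv> colouring_algebra P c"

text \<open>
  The label of the \<open>k\<close>-th edge on the path to \<open>u\<close>. Indexing by position makes the labels on a
  path a sequence of random variables with index set \<open>{..<length u}\<close>.
\<close>
definition edge_label :: "'c list \<Rightarrow> nat \<Rightarrow> 'w \<Rightarrow> real" where
  "edge_label u k = \<zeta> (take k u) (take (Suc k) u)"

lemma path_edge: "k < length u \<Longrightarrow> (take k u, take (Suc k) u) \<in> tree_edges"
  by (auto simp: tree_edges_def take_Suc_conv_app_nth)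

lemma edge_label_measurable: "k < length u \<Longrightarrow> edge_label u k \<in> borel_measurable P"
  unfolding edge_label_def by (intro label_measurable path_edge)

lemma vertex_value_eq: "vertex_value \<zeta> u \<omega> = (\<Prod>k<length u. edge_label u k \<omega>)"
  by (simp add: vertex_value_def edge_label_def)

lemma vertex_value_measurable: "vertex_value \<zeta> u \<in> borel_measurable P"
proof -
  have "(\<lambda>\<omega>. \<Prod>k<length u. edge_label u k \<omega>) \<in> borel_measurable P"
    by (intro borel_measurable_prod edge_label_measurable) auto
  then show ?thesis by (simp add: vertex_value_eq[abs_def])
qed

lemma colouring_measurable:
  "(\<lambda>\<omega> u. c u \<omega>) \<in> measurable P (\<Pi>\<^sub>M u\<in>UNIV. count_space UNIV)"
  by (rule measurable_PiM_single') (auto simp: colour_measurable)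

lemma space_F: "space F = space P"
  by (simp add: colouring_algebra_def)

lemma subalgebra_F: "subalgebra P F"
proof -
  have "sets F \<subseteq> sets P"
    unfolding colouring_algebra_def
    by (subst sets_vimage_algebra2)
      (auto simp: space_PiM intro!: measurable_sets[OF colouring_measurable, simplified])
  then show ?thesis by (simp add: subalgebra_def space_F)
qed

lemma sigma_finite_subalgebra_F: "sigma_finite_subalgebra P F"
  by (intro finite_measure_subalgebra_is_sigma_finite finite_measure_subalgebra.intro
      finite_measure_subalgebra_axioms.intro P.finite_measure_axioms subalgebra_F)

lemma colour_measurable_F: "c u \<in> measurable F (count_space UNIV)"
proof -
  have "(\<lambda>\<omega> u. c u \<omega>) \<in> measurable F (\<Pi>\<^sub>M u\<in>UNIV. count_space UNIV)"
    unfolding colouring_algebra_def by (rule measurable_vimage_algebra1) (auto simp: space_PiM)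
  from measurable_compose[OF this measurable_component_singleton[of u UNIV]]
  show ?thesis by simp
qed

text \<open>
  The defining property of conditional probability, which turns the almost sure identities of
  the model into statements about unconditional probabilities.
\<close>
lemma prob_Int_eq_integral_prob_given:
  assumes A: "A \<in> sets P" and G: "G \<in> sets F"
  shows "P.prob (A \<inter> G) = (LINT \<omega>|P. indicator G \<omega> * prob_given P F A \<omega>)"
proof -
  interpret sigma_finite_subalgebra P F by (rule sigma_finite_subalgebra_F)
  have G': "G \<in> sets P" using G subalgebra_F by (auto simp: subalgebra_def)
  have "(LINT \<omega>:G|P. indicator A \<omega>) = (LINT \<omega>:G|P. real_cond_exp P F (indicator A) \<omega>)"
    using A G by (intro real_cond_exp_intA) (auto simp: P.emeasure_eq_measure)
  moreover have "(LINT \<omega>:G|P. indicator A \<omega>) = P.prob (A \<inter> G)"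
  proof -
    have "(LINT \<omega>:G|P. indicator A \<omega>) = (LINT \<omega>|P. indicat_real (A \<inter> G) \<omega>)"
      unfolding set_lebesgue_integral_def
      by (intro Bochner_Integration.integral_cong) (auto simp: indicator_def)
    then show ?thesis using A G' by simp
  qed
  ultimately show ?thesis
    by (simp add: set_lebesgue_integral_def prob_given_def)
qed

lemma children_measurable: "(\<lambda>\<omega> k. c (u @ [k]) \<omega>) \<in> measurable P (count_space UNIV)"
  using colour_children_indep unfolding P.indep_vars_def2 by auto

lemma child_colour_prob: "P.prob {\<omega> \<in> space P. c (u @ [k]) \<omega> = j} = 1 / real CARD('c)"
proof -
  let ?X = "\<lambda>\<omega> k. c (u @ [k]) \<omega>" and ?bij = "{f :: 'c \<Rightarrow> 'c. bij f}"
  have "id \<in> ?bij" by simp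
  then have ne: "?bij \<noteq> {}" by blast
  have fin: "finite ?bij" by (rule finite_subset[of _ UNIV]) auto
  have "P.prob {\<omega> \<in> space P. c (u @ [k]) \<omega> = j} = P.prob (?X -` {f. f k = j} \<inter> space P)"
    by (rule arg_cong[where f = P.prob]) auto
  also have "\<dots> = measure (distr P (count_space UNIV) ?X) {f. f k = j}"
    by (subst measure_distr[OF children_measurable]) auto
  also have "\<dots> = measure_pmf.prob (pmf_of_set ?bij) {f. f k = j}"
    by (simp add: colour_children_uniform)
  also have "\<dots> = card (?bij \<inter> {f. f k = j}) / card ?bij"
    by (rule measure_pmf_of_set[OF ne fin])
  also have "?bij \<inter> {f. f k = j} = {f. bij f \<and> f k = j}" by auto
  also have "real (card {f. bij f \<and> f k = j}) / card ?bij = 1 / real CARD('c)"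
  proof -
    have "card ?bij \<noteq> 0" using ne fin by simp
    moreover have "real (card {f. bij f \<and> f k = j}) * real CARD('c) = real (card ?bij)"
      by (simp only: card_bij_with_value[of k j, symmetric] of_nat_mult)
    ultimately show ?thesis by (simp add: field_simps)
  qed
  finally show ?thesis .
qed

definition colour_path_event :: "'c list \<Rightarrow> 'c list \<Rightarrow> 'w set" where
  "colour_path_event u js = {\<omega> \<in> space P. \<forall>k<length u. c (take (Suc k) u) \<omega> = js ! k}"

lemma colour_path_event_F: "colour_path_event u js \<in> sets F"
proof -
  have colour_event: "{\<omega> \<in> space F. c v \<omega> = j} \<in> sets F" for v j
  proof -
    have eq: "{\<omega> \<in> space F. c v \<omega> = j} = c v -` {j} \<inter> space F" by blast
    show ?thesis unfolding eq by (rule measurable_sets[OF colour_measurable_F]) simp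
  qed
  have "{\<omega> \<in> space F. \<forall>k\<in>{..<length u}. c (take (Suc k) u) \<omega> = js ! k} \<in> sets F"
    by (rule sets_Collect_finite_Ball[OF finite_lessThan colour_event])
  moreover have "colour_path_event u js = {\<omega> \<in> space F. \<forall>k\<in>{..<length u}. c (take (Suc k) u) \<omega> = js ! k}"
    unfolding colour_path_event_def space_F by blast
  ultimately show ?thesis by simp
qed

lemma colour_path_event_P: "colour_path_event u js \<in> sets P"
  using colour_path_event_F subalgebra_F by (auto simp: subalgebra_def)

lemma take_inj: "inj_on (\<lambda>k. take k u) {..<length u}"
  by (rule inj_onI) (metis length_take lessThan_iff less_imp_le min.absorb2)

text \<open>
  Every vertex on the path picks the colour of its successor from its own uniform bijection,
  and the bijections of distinct vertices are independent.
\<close>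
lemma colour_path_prob: "P.prob (colour_path_event u js) = (1 / real CARD('c)) ^ length u"
proof (cases "u = []")
  case True
  then show ?thesis by (simp add: colour_path_event_def P.prob_space)
next
  case False
  let ?X = "\<lambda>v \<omega> k. c (v @ [k]) \<omega>" and ?J = "(\<lambda>k. take k u) ` {..<length u}"
    and ?A = "\<lambda>v. {f :: 'c \<Rightarrow> 'c. f (u ! length v) = js ! length v}"
  have "colour_path_event u js = (\<Inter>v\<in>?J. ?X v -` ?A v \<inter> space P)"
    using False by (auto simp: colour_path_event_def take_Suc_conv_app_nth)
  also have "P.prob \<dots> = (\<Prod>v\<in>?J. P.prob (?X v -` ?A v \<inter> space P))"
    using False by (intro P.indep_varsD[OF colour_children_indep]) auto
  also have "\<dots> = (\<Prod>v\<in>?J. 1 / real CARD('c))"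
  proof (rule prod.cong)
    fix v
    have "?X v -` ?A v \<inter> space P = {\<omega> \<in> space P. c (v @ [u ! length v]) \<omega> = js ! length v}"
      by auto
    then show "P.prob (?X v -` ?A v \<inter> space P) = 1 / real CARD('c)"
      by (simp only: child_colour_prob)
  qed simp
  also have "\<dots> = (1 / real CARD('c)) ^ length u"
    using card_image[OF take_inj[of u]] by simp
  finally show ?thesis .
qed

lemma label_event_measurable:
  assumes B: "\<And>k. k < length u \<Longrightarrow> B k \<in> sets borel"
  shows "{\<omega> \<in> space P. \<forall>k<length u. edge_label u k \<omega> \<in> B k} \<in> sets P"
proof -
  have label_event: "{\<omega> \<in> space P. edge_label u k \<omega> \<in> B k} \<in> sets P" if "k \<in> {..<length u}" for k
  proof -
    have eq: "{\<omega> \<in> space P. edge_label u k \<omega> \<in> B k} = edge_label u k -` B k \<inter> space P" by blast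
    show ?thesis unfolding eq using that by (intro measurable_sets[OF edge_label_measurable[of k u]] B) simp_all
  qed
  have "{\<omega> \<in> space P. \<forall>k\<in>{..<length u}. edge_label u k \<omega> \<in> B k} \<in> sets P"
    by (rule sets_Collect_finite_Ball[OF finite_lessThan label_event])
  then show ?thesis by (simp only: lessThan_iff Ball_def)
qed

text \<open>
  On the event that the colours on the path are \<open>js\<close>, the conditional probability of the label
  event is constant, because the labels are conditionally independent and each
  conditional law depends on the two end colours only. The start vertices of the edges on a
  path are distinct, so that the independence assumption applies.
\<close>
lemma colour_label_prob:
  assumes B: "\<And>k. k < length u \<Longrightarrow> B k \<in> sets borel"
  shows "P.prob ({\<omega> \<in> space P. \<forall>k<length u. edge_label u k \<omega> \<in> B k} \<inter> colour_path_event u js)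
    = (1 / real CARD('c)) ^ length u *
      (\<Prod>k<length u. measure N {x \<in> space N. \<xi> ((root_colour # js) ! k) (js ! k) x \<in> B k})"
proof -
  let ?n = "length u" and ?G = "colour_path_event u js"
  let ?A = "{\<omega> \<in> space P. \<forall>k<?n. edge_label u k \<omega> \<in> B k}"
  define e where "e = (\<lambda>k. (take k u, take (Suc k) u))"
  define B' where "B' = (\<lambda>e :: 'c list \<times> 'c list. B (length (fst e)))"
  have e: "e k \<in> tree_edges" if "k < ?n" for k using path_edge[OF that] by (simp add: e_def)
  have inj: "inj_on e {..<?n}" "inj_on fst (e ` {..<?n})"
    using take_inj[of u] by (auto simp: inj_on_def e_def)
  have B'e: "B' (e k) = B k" if "k < ?n" for k using that by (simp add: B'_def e_def)
  have event: "{\<omega> \<in> space P. \<forall>(v, w)\<in>e ` {..<?n}. \<zeta> v w \<omega> \<in> B' (v, w)} = ?A"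
    using B'e by (auto simp: e_def edge_label_def)
  have A: "?A \<in> sets P" by (rule label_event_measurable[OF B])
  have "AE \<omega> in P. prob_given P F ?A \<omega> =
      (\<Prod>(v, w)\<in>e ` {..<?n}. prob_given P F {\<omega> \<in> space P. \<zeta> v w \<omega> \<in> B' (v, w)} \<omega>)"
    unfolding event[symmetric] using e B inj(2) B'e by (intro label_indep) auto
  moreover have "AE \<omega> in P. \<forall>k\<in>{..<?n}. prob_given P F {\<omega> \<in> space P. edge_label u k \<omega> \<in> B k} \<omega>
      = measure N {x \<in> space N. \<xi> (c (take k u) \<omega>) (c (take (Suc k) u) \<omega>) x \<in> B k}"
    unfolding edge_label_def using B
    by (intro AE_finite_allI label_law path_edge) auto
  ultimately have AE: "AE \<omega> in P. indicator ?G \<omega> * prob_given P F ?A \<omega> = indicator ?G \<omega> *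
      (\<Prod>k<?n. measure N {x \<in> space N. \<xi> ((root_colour # js) ! k) (js ! k) x \<in> B k})"
    using AE_space
  proof eventually_elim
    case (elim \<omega>)
    show ?case
    proof (cases "\<omega> \<in> ?G")
      case True
      have "prob_given P F ?A \<omega> = (\<Prod>k<?n. prob_given P F {\<omega> \<in> space P. edge_label u k \<omega> \<in> B k} \<omega>)"
        unfolding elim(1) by (subst prod.reindex[OF inj(1)])
          (auto intro!: prod.cong simp: B'_def e_def edge_label_def)
      also have "\<dots> = (\<Prod>k<?n. measure N {x \<in> space N. \<xi> ((root_colour # js) ! k) (js ! k) x \<in> B k})"
      proof (rule prod.cong)
        fix k assume k: "k \<in> {..<?n}"
        have "c (take k u) \<omega> = (root_colour # js) ! k"
          using True k elim(3) by (cases k) (auto simp: colour_path_event_def colour_root)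
        moreover have "c (take (Suc k) u) \<omega> = js ! k"
          using True k by (simp add: colour_path_event_def)
        ultimately show "prob_given P F {\<omega> \<in> space P. edge_label u k \<omega> \<in> B k} \<omega>
          = measure N {x \<in> space N. \<xi> ((root_colour # js) ! k) (js ! k) x \<in> B k}"
          using elim(2) k by simp
      qed simp
      finally show ?thesis by simp
    qed simp
  qed
  have "P.prob (?A \<inter> ?G) = (LINT \<omega>|P. indicator ?G \<omega> * prob_given P F ?A \<omega>)"
    by (rule prob_Int_eq_integral_prob_given[OF A colour_path_event_F])
  also have "\<dots> = (LINT \<omega>|P. indicator ?G \<omega> *
      (\<Prod>k<?n. measure N {x \<in> space N. \<xi> ((root_colour # js) ! k) (js ! k) x \<in> B k}))"
    using AE colour_path_event_P
    by (intro integral_cong_AE)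
      (auto simp: prob_given_def intro!: borel_measurable_times borel_measurable_cond_exp2)
  also have "\<dots> = P.prob ?G *
      (\<Prod>k<?n. measure N {x \<in> space N. \<xi> ((root_colour # js) ! k) (js ! k) x \<in> B k})"
    using colour_path_event_P by simp
  finally show ?thesis by (simp add: colour_path_prob)
qed

section \<open>Moments of vertex values\<close>

text \<open>
  Under the conditional measure \<open>Q\<close> given the colour path, \<open>colour_label_prob\<close> says that the
  labels are independent, the \<open>k\<close>-th one being distributed as the \<open>\<xi>\<close> of its end colours. The
  expectation of the product therefore factorises.
\<close>
lemma colour_path_moment:
  fixes u js :: "'c list" and s :: real
  assumes js: "length js = length u" and int: "\<And>i j. integrable N (\<lambda>x. \<xi> i j x powr s)"
  shows "(\<integral>\<^sup>+\<omega>. ennreal (vertex_value \<zeta> u \<omega> powr s) * indicator (colour_path_event u js) \<omega> \<partial>P)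
    = ennreal ((1 / real CARD('c)) ^ length u * path_weight (\<lambda>i j. \<integral>x. \<xi> i j x powr s \<partial>N) root_colour js)"
proof -
  let ?n = "length u" and ?G = "colour_path_event u js"
  let ?\<xi> = "\<lambda>k. \<xi> ((root_colour # js) ! k) (js ! k)"
  define Q where "Q = uniform_measure P ?G"
  have prob_G: "P.prob ?G = (1 / real CARD('c)) ^ ?n" by (rule colour_path_prob)
  then have G: "emeasure P ?G \<noteq> 0" "emeasure P ?G \<noteq> \<infinity>"
    by (auto simp: P.emeasure_eq_measure)
  interpret Q: prob_space Q unfolding Q_def by (rule prob_space_uniform_measure[OF G])
  have sets_Q: "sets Q = sets P" "space Q = space P" by (simp_all add: Q_def)
  have label_Q: "edge_label u k \<in> borel_measurable Q" if "k < ?n" for k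
    using edge_label_measurable[OF that] by (simp only: measurable_cong_sets[OF sets_Q(1) refl])
  have prob_Q: "Q.prob {\<omega> \<in> space P. \<forall>k<?n. edge_label u k \<omega> \<in> B k}
      = (\<Prod>k<?n. measure N {x \<in> space N. ?\<xi> k x \<in> B k})"
    if B: "\<And>k. k < ?n \<Longrightarrow> B k \<in> sets borel" for B
  proof -
    let ?X = "{\<omega> \<in> space P. \<forall>k<?n. edge_label u k \<omega> \<in> B k}"
    have "Q.prob ?X = P.prob (?G \<inter> ?X) / P.prob ?G"
      unfolding Q_def by (rule measure_uniform_measure[OF G label_event_measurable[OF B]])
    also have "P.prob (?G \<inter> ?X) = P.prob ?G * (\<Prod>k<?n. measure N {x \<in> space N. ?\<xi> k x \<in> B k})"
      unfolding Int_commute[of ?G] prob_G by (rule colour_label_prob[OF B])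
    finally show ?thesis by (simp add: prob_G)
  qed
  have prob_Q1: "Q.prob {\<omega> \<in> space P. edge_label u k \<omega> \<in> A} = measure N {x \<in> space N. ?\<xi> k x \<in> A}"
    if k: "k < ?n" and A: "A \<in> sets borel" for k A
  proof -
    (* A one-dimensional marginal is the joint law with trivial conditions on the other labels. *)
    define B where "B = (\<lambda>l. if l = k then A else UNIV)"
    have "{\<omega> \<in> space P. edge_label u k \<omega> \<in> A} = {\<omega> \<in> space P. \<forall>l<?n. edge_label u l \<omega> \<in> B l}"
      using k by (auto simp: B_def)
    also have "Q.prob \<dots> = (\<Prod>l<?n. measure N {x \<in> space N. ?\<xi> l x \<in> B l})"
      using A by (intro prob_Q) (auto simp: B_def)
    also have "\<dots> = (\<Prod>l<?n. if l = k then measure N {x \<in> space N. ?\<xi> k x \<in> A} else 1)"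
      by (intro prod.cong) (auto simp: B_def N.prob_space)
    also have "\<dots> = measure N {x \<in> space N. ?\<xi> k x \<in> A}" using k by simp
    finally show ?thesis .
  qed
  have indep: "Q.indep_vars (\<lambda>_. borel) (edge_label u) {..<?n}"
  proof (cases "?n = 0")
    case True
    then show ?thesis by (simp add: Q.indep_vars_def2 Q.indep_sets_def)
  next
    case False
    show ?thesis
      unfolding Q.indep_vars_def2
    proof (intro conjI ballI)
      show "Q.indep_sets (\<lambda>k. {edge_label u k -` A \<inter> space Q |A. A \<in> sets borel}) {..<?n}"
      proof (subst Q.indep_sets_finite)
        show "\<forall>A\<in>Pi {..<?n} (\<lambda>k. {edge_label u k -` A \<inter> space Q |A. A \<in> sets borel}).
            Q.prob (\<Inter>k\<in>{..<?n}. A k) = (\<Prod>k<?n. Q.prob (A k))"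
        proof
          fix A assume "A \<in> Pi {..<?n} (\<lambda>k. {edge_label u k -` A \<inter> space Q |A. A \<in> sets borel})"
          then have "\<forall>k\<in>{..<?n}. \<exists>B. A k = edge_label u k -` B \<inter> space Q \<and> B \<in> sets borel"
            by auto
          then obtain B where B: "\<And>k. k < ?n \<Longrightarrow> A k = edge_label u k -` B k \<inter> space Q"
              "\<And>k. k < ?n \<Longrightarrow> B k \<in> sets borel"
            by (metis lessThan_iff)
          have A_eq: "A k = {\<omega> \<in> space P. edge_label u k \<omega> \<in> B k}" if "k < ?n" for k
            using B(1)[OF that] by (auto simp: sets_Q)
          have "(\<Inter>k\<in>{..<?n}. A k) = {\<omega> \<in> space P. \<forall>k<?n. edge_label u k \<omega> \<in> B k}"
            using False by (auto simp: A_eq)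
          also have "Q.prob \<dots> = (\<Prod>k<?n. measure N {x \<in> space N. ?\<xi> k x \<in> B k})"
            by (rule prob_Q[OF B(2)])
          also have "\<dots> = (\<Prod>k<?n. Q.prob (A k))"
            using B(2) by (intro prod.cong) (auto simp: A_eq prob_Q1)
          finally show "Q.prob (\<Inter>k\<in>{..<?n}. A k) = (\<Prod>k<?n. Q.prob (A k))" .
        qed
      next
        show "{edge_label u k -` A \<inter> space Q |A. A \<in> sets borel} \<subseteq> Q.events" if "k \<in> {..<?n}" for k
          using measurable_sets[OF label_Q] that by auto
        show "space Q \<in> {edge_label u k -` A \<inter> space Q |A. A \<in> sets borel}" for k
          by (auto intro!: exI[of _ UNIV])
      qed (use False in auto)
    qed (use label_Q in auto)
  qed
  have distr_eq: "distr Q borel (edge_label u k) = distr N borel (?\<xi> k)" if k: "k < ?n" for k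
  proof (rule measure_eqI)
    fix A assume "A \<in> sets (distr Q borel (edge_label u k))"
    then have A: "A \<in> sets borel" by simp
    have "edge_label u k -` A \<inter> space Q = {\<omega> \<in> space P. edge_label u k \<omega> \<in> A}"
      "?\<xi> k -` A \<inter> space N = {x \<in> space N. ?\<xi> k x \<in> A}" by (auto simp: sets_Q)
    then show "emeasure (distr Q borel (edge_label u k)) A = emeasure (distr N borel (?\<xi> k)) A"
      using prob_Q1[OF k A] A label_Q[OF k] \<xi>_measurable
      by (simp add: emeasure_distr Q.emeasure_eq_measure N.emeasure_eq_measure)
  qed simp
  have moment: "(\<integral>\<^sup>+\<omega>. ennreal (edge_label u k \<omega> powr s) \<partial>Q) = ennreal (\<integral>x. ?\<xi> k x powr s \<partial>N)"
    if k: "k < ?n" for k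
  proof -
    have "(\<integral>\<^sup>+\<omega>. ennreal (edge_label u k \<omega> powr s) \<partial>Q)
        = (\<integral>\<^sup>+y. ennreal (y powr s) \<partial>distr Q borel (edge_label u k))"
      by (subst nn_integral_distr[OF label_Q[OF k]]) auto
    also have "\<dots> = (\<integral>\<^sup>+x. ennreal (?\<xi> k x powr s) \<partial>N)"
      unfolding distr_eq[OF k] by (subst nn_integral_distr) (auto simp: \<xi>_measurable)
    also have "\<dots> = ennreal (\<integral>x. ?\<xi> k x powr s \<partial>N)"
      by (intro nn_integral_eq_integral int) auto
    finally show ?thesis .
  qed
  have "Q.indep_vars (\<lambda>_. borel) (\<lambda>k. (\<lambda>y. ennreal (y powr s)) \<circ> edge_label u k) {..<?n}"
    using indep by (rule Q.indep_vars_compose) simp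
  then have "(\<integral>\<^sup>+\<omega>. (\<Prod>k<?n. ennreal (edge_label u k \<omega> powr s)) \<partial>Q)
      = (\<Prod>k<?n. \<integral>\<^sup>+\<omega>. ennreal (edge_label u k \<omega> powr s) \<partial>Q)"
    by (intro Q.indep_vars_nn_integral) (auto simp: comp_def)
  also have "\<dots> = (\<Prod>k<?n. ennreal (\<integral>x. ?\<xi> k x powr s \<partial>N))"
    by (intro prod.cong) (auto simp: moment)
  also have "\<dots> = ennreal (path_weight (\<lambda>i j. \<integral>x. \<xi> i j x powr s \<partial>N) root_colour js)"
    unfolding path_weight_eq_prod js by (rule prod_ennreal) (auto intro!: Bochner_Integration.integral_nonneg)
  finally have Q_moment: "(\<integral>\<^sup>+\<omega>. ennreal (vertex_value \<zeta> u \<omega> powr s) \<partial>Q)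
      = ennreal (path_weight (\<lambda>i j. \<integral>x. \<xi> i j x powr s \<partial>N) root_colour js)"
    by (simp add: vertex_value_eq prod_powr_distrib prod_ennreal)
  let ?I = "\<integral>\<^sup>+\<omega>. ennreal (vertex_value \<zeta> u \<omega> powr s) * indicator ?G \<omega> \<partial>P"
  have "(\<integral>\<^sup>+\<omega>. ennreal (vertex_value \<zeta> u \<omega> powr s) \<partial>Q) = ?I / emeasure P ?G"
    unfolding Q_def using vertex_value_measurable[of u] colour_path_event_P
    by (intro nn_integral_uniform_measure) auto
  moreover have "?I = ?I / emeasure P ?G * emeasure P ?G"
    using mult_divide_eq_ennreal[of "emeasure P ?G" ?I] G by (simp add: divide_ennreal_def mult_ac)
  ultimately have "?I = (\<integral>\<^sup>+\<omega>. ennreal (vertex_value \<zeta> u \<omega> powr s) \<partial>Q) * emeasure P ?G"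
    by simp
  then show ?thesis
    by (simp add: Q_moment P.emeasure_eq_measure prob_G ennreal_mult' mult.commute)
qed

lemma sum_indicator_colour_path_event:
  fixes u :: "'c list"
  assumes \<omega>: "\<omega> \<in> space P"
  shows "(\<Sum>js | length js = length u. indicator (colour_path_event u js) \<omega>) = (1 :: ennreal)"
proof -
  define js0 where "js0 = map (\<lambda>k. c (take (Suc k) u) \<omega>) [0..<length u]"
  have js0: "length js0 = length u" "\<And>k. k < length u \<Longrightarrow> js0 ! k = c (take (Suc k) u) \<omega>"
    by (simp_all add: js0_def)
  have event: "\<omega> \<in> colour_path_event u js \<longleftrightarrow> js = js0" if js: "length js = length u" for js
  proof
    assume "\<omega> \<in> colour_path_event u js"
    then have "js ! k = js0 ! k" if "k < length js" for k
      using that js js0(2) by (simp add: colour_path_event_def)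
    then show "js = js0" using js js0(1) by (intro nth_equalityI) simp_all
  next
    assume "js = js0"
    then show "\<omega> \<in> colour_path_event u js" using \<omega> js0(2) by (simp add: colour_path_event_def)
  qed
  have "(\<Sum>js | length js = length u. indicator (colour_path_event u js) \<omega>)
      = (\<Sum>js | length js = length u. if js = js0 then 1 else 0 :: ennreal)"
    by (rule sum.cong[OF refl]) (simp add: event indicator_def)
  also have "\<dots> = 1"
    by (subst sum.delta[OF finite_length_eq]) (simp add: js0(1))
  finally show ?thesis .
qed

text \<open>
  The events of the possible colour paths to \<open>u\<close> partition the probability space.
\<close>
lemma vertex_moment:
  fixes u :: "'c list" and s :: real
  assumes int: "\<And>i j. integrable N (\<lambda>x. \<xi> i j x powr s)"
  shows "(\<integral>\<^sup>+\<omega>. ennreal (vertex_value \<zeta> u \<omega> powr s) \<partial>P)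
    = ennreal ((1 / real CARD('c)) ^ length u *
        (\<Sum>js | length js = length u. path_weight (\<lambda>i j. \<integral>x. \<xi> i j x powr s \<partial>N) root_colour js))"
proof -
  let ?J = "{js :: 'c list. length js = length u}"
  have "(\<integral>\<^sup>+\<omega>. ennreal (vertex_value \<zeta> u \<omega> powr s) \<partial>P)
      = (\<integral>\<^sup>+\<omega>. (\<Sum>js\<in>?J. ennreal (vertex_value \<zeta> u \<omega> powr s) * indicator (colour_path_event u js) \<omega>) \<partial>P)"
    by (intro nn_integral_cong) (simp only: sum_distrib_left[symmetric] sum_indicator_colour_path_event mult_1_right)
  also have "\<dots> = (\<Sum>js\<in>?J. \<integral>\<^sup>+\<omega>. ennreal (vertex_value \<zeta> u \<omega> powr s) * indicator (colour_path_event u js) \<omega> \<partial>P)"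
    using vertex_value_measurable[of u] colour_path_event_P
    by (intro nn_integral_sum) auto
  also have "\<dots> = (\<Sum>js\<in>?J. ennreal ((1 / real CARD('c)) ^ length u * path_weight (\<lambda>i j. \<integral>x. \<xi> i j x powr s \<partial>N) root_colour js))"
    by (rule sum.cong[OF refl], rule colour_path_moment[OF _ int]) simp
  also have "\<dots> = ennreal (\<Sum>js\<in>?J. (1 / real CARD('c)) ^ length u * path_weight (\<lambda>i j. \<integral>x. \<xi> i j x powr s \<partial>N) root_colour js)"
    by (rule sum_ennreal) (auto simp: path_weight_eq_prod intro!: mult_nonneg_nonneg prod_nonneg Bochner_Integration.integral_nonneg)
  finally show ?thesis by (simp only: sum_distrib_left)
qed

sublocale labels: label_family N \<xi>
  by unfold_locales (auto simp: \<xi>_measurable \<xi>_positive)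

lemma edge_label_pos:
  assumes k: "k < length u"
  shows "AE \<omega> in P. 0 < edge_label u k \<omega>"
proof -
  let ?A = "{\<omega> \<in> space P. edge_label u k \<omega> \<in> {0<..}}"
  have "edge_label u k -` {0<..} \<inter> space P \<in> sets P"
    by (rule measurable_sets[OF edge_label_measurable[OF k]]) simp
  moreover have "edge_label u k -` {0<..} \<inter> space P = ?A" by blast
  ultimately have A: "?A \<in> sets P" by simp
  have N1: "measure N {x \<in> space N. \<xi> i j x \<in> {0<..}} = 1" for i j
  proof -
    have "AE x in N. x \<in> {x \<in> space N. \<xi> i j x \<in> {0<..}}"
      using \<xi>_positive[of i j] AE_space by eventually_elim simp
    then show ?thesis by (rule N.prob_eq_1[THEN iffD2, rotated]) (use \<xi>_measurable in measurable)
  qed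
  have "AE \<omega> in P. prob_given P F ?A \<omega> = 1"
    using label_law[OF path_edge[OF k], of "{0<..}"] unfolding edge_label_def by (simp only: N1) simp
  then have "(LINT \<omega>|P. indicator (space P) \<omega> * prob_given P F ?A \<omega>) = (LINT \<omega>|P. 1)"
    by (intro integral_cong_AE) (auto simp: prob_given_def intro!: borel_measurable_times borel_measurable_cond_exp2)
  moreover have "space P \<in> sets F" using sets.top[of F] by (simp add: space_F)
  ultimately have "P.prob (?A \<inter> space P) = 1"
    using prob_Int_eq_integral_prob_given[OF A] by (simp add: P.prob_space)
  moreover have "?A \<inter> space P = ?A" by blast
  ultimately have "AE \<omega> in P. \<omega> \<in> ?A" using P.prob_eq_1[OF A] by simp
  then show ?thesis by eventually_elim simp
qed

lemma vertex_value_pos: "AE \<omega> in P. 0 < vertex_value \<zeta> u \<omega>"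
proof -
  have "AE \<omega> in P. \<forall>k\<in>{..<length u}. 0 < edge_label u k \<omega>"
    by (rule AE_finite_allI) (auto intro: edge_label_pos)
  then show ?thesis by eventually_elim (auto simp: vertex_value_eq intro: prod_pos)
qed

text \<open>
  Comparing with a Perron eigenvector of the moment matrix turns the sum over colour paths
  into a power of \<open>\<rho>(s)\<close>.
\<close>
lemma vertex_moment_bounds:
  assumes s: "s \<in> moment_domain N \<xi>"
  shows "\<exists>a b. 0 < a \<and> 0 < b \<and> (\<forall>u. integrable P (\<lambda>\<omega>. vertex_value \<zeta> u \<omega> powr s) \<and>
    a * (rho N \<xi> s / real CARD('c)) ^ length u \<le> P.expectation (\<lambda>\<omega>. vertex_value \<zeta> u \<omega> powr s) \<and>
    P.expectation (\<lambda>\<omega>. vertex_value \<zeta> u \<omega> powr s) \<le> b * (rho N \<xi> s / real CARD('c)) ^ length u)"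
proof -
  let ?m = "\<lambda>i j. \<integral>x. \<xi> i j x powr s \<partial>N"
  let ?W = "\<lambda>n. \<Sum>js | length js = n. path_weight ?m root_colour js"
  obtain v where v: "\<And>i. 0 < v $ i" "moment_matrix N \<xi> s *v v = rho N \<xi> s *s v" "0 < rho N \<xi> s"
    using labels.perron_moment_matrix[OF s] by blast
  have eigen: "(\<Sum>j\<in>UNIV. ?m i j * v $ j) = rho N \<xi> s * v $ i" for i
  proof -
    have "(moment_matrix N \<xi> s *v v) $ i = rho N \<xi> s * v $ i" by (simp add: v(2))
    then show ?thesis by (simp add: matrix_vector_mult_def labels.moment_matrix_nth)
  qed
  have m: "0 < ?m i j" for i j
    using labels.moment_pos[OF s, of i j] by (simp add: labels.moment_matrix_nth)
  obtain a b where "0 < a \<and> 0 < b \<and>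
      (\<forall>n i. a * rho N \<xi> s ^ n \<le> (\<Sum>js | length js = n. path_weight ?m i js)) \<and>
      (\<forall>n i. (\<Sum>js | length js = n. path_weight ?m i js) \<le> b * rho N \<xi> s ^ n)"
    using sum_path_weight_bounds[of ?m "\<lambda>i. v $ i", OF m v(1,3) eigen] by (elim exE)
  then have ab: "0 < a" "0 < b"
    "\<And>n i. a * rho N \<xi> s ^ n \<le> (\<Sum>js | length js = n. path_weight ?m i js)"
    "\<And>n i. (\<Sum>js | length js = n. path_weight ?m i js) \<le> b * rho N \<xi> s ^ n"
    by simp_all
  have W0: "0 \<le> ?W n" for n
    by (rule order_trans[OF _ ab(3)]) (use ab(1) v(3) in simp)
  have nn: "(\<integral>\<^sup>+\<omega>. ennreal (vertex_value \<zeta> u \<omega> powr s) \<partial>P) = ennreal ((1 / real CARD('c)) ^ length u * ?W (length u))" for u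
    by (rule vertex_moment) (rule labels.moment_integrable[OF s])
  have meas: "(\<lambda>\<omega>. vertex_value \<zeta> u \<omega> powr s) \<in> borel_measurable P" for u
    using vertex_value_measurable[of u] by measurable
  have expect: "P.expectation (\<lambda>\<omega>. vertex_value \<zeta> u \<omega> powr s) = (1 / real CARD('c)) ^ length u * ?W (length u)" for u
  proof -
    have "P.expectation (\<lambda>\<omega>. vertex_value \<zeta> u \<omega> powr s) = enn2real (\<integral>\<^sup>+\<omega>. ennreal (vertex_value \<zeta> u \<omega> powr s) \<partial>P)"
      by (rule integral_eq_nn_integral[OF meas]) simp
    also have "\<dots> = (1 / real CARD('c)) ^ length u * ?W (length u)"
      unfolding nn by (rule enn2real_ennreal) (intro mult_nonneg_nonneg W0, simp)
    finally show ?thesis .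
  qed
  have pow: "(1 / real CARD('c)) ^ n * (x * rho N \<xi> s ^ n) = x * (rho N \<xi> s / real CARD('c)) ^ n" for n x
    by (simp add: power_divide)
  show ?thesis
  proof (rule exI[of _ a], rule exI[of _ b], intro conjI allI ab(1,2))
    show "integrable P (\<lambda>\<omega>. vertex_value \<zeta> u \<omega> powr s)" for u
      by (rule integrableI_nn_integral_finite[OF meas _ nn]) simp
    show "a * (rho N \<xi> s / real CARD('c)) ^ length u \<le> P.expectation (\<lambda>\<omega>. vertex_value \<zeta> u \<omega> powr s)" for u
      unfolding expect pow[symmetric] by (intro mult_left_mono ab) simp
    show "P.expectation (\<lambda>\<omega>. vertex_value \<zeta> u \<omega> powr s) \<le> b * (rho N \<xi> s / real CARD('c)) ^ length u" for u
      unfolding expect pow[symmetric] by (intro mult_left_mono ab) simp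
  qed
qed

section \<open>Tails of vertex values\<close>

lemma value_event_measurable: "{\<omega> \<in> space P. x \<le> vertex_value \<zeta> u \<omega>} \<in> sets P"
proof -
  have "vertex_value \<zeta> u -` {x..} \<inter> space P \<in> sets P"
    by (rule measurable_sets[OF vertex_value_measurable]) simp
  moreover have "vertex_value \<zeta> u -` {x..} \<inter> space P = {\<omega> \<in> space P. x \<le> vertex_value \<zeta> u \<omega>}" by auto
  ultimately show ?thesis by simp
qed

lemma value_tail_upper:
  assumes s: "0 \<le> s" and int: "integrable P (\<lambda>\<omega>. vertex_value \<zeta> u \<omega> powr s)"
  shows "P.prob {\<omega> \<in> space P. exp (- t) \<le> vertex_value \<zeta> u \<omega>}
    \<le> exp (s * t) * P.expectation (\<lambda>\<omega>. vertex_value \<zeta> u \<omega> powr s)"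
proof -
  let ?A = "{\<omega> \<in> space P. exp (- t) \<le> vertex_value \<zeta> u \<omega>}"
  have "P.expectation (indicat_real ?A) \<le> P.expectation (\<lambda>\<omega>. exp (s * t) * vertex_value \<zeta> u \<omega> powr s)"
  proof (rule integral_mono_AE)
    show "integrable P (indicat_real ?A)"
      using value_event_measurable by (intro integrable_real_indicator) (auto simp: P.emeasure_eq_measure)
    show "integrable P (\<lambda>\<omega>. exp (s * t) * vertex_value \<zeta> u \<omega> powr s)" using int by simp
    show "AE \<omega> in P. indicat_real ?A \<omega> \<le> exp (s * t) * vertex_value \<zeta> u \<omega> powr s"
      using vertex_value_pos[of u]
    proof eventually_elim
      case (elim \<omega>)
      show ?case
      proof (cases "\<omega> \<in> ?A")
        case True
        then have "- t \<le> ln (vertex_value \<zeta> u \<omega>)" using elim by (simp add: ln_ge_iff)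
        then have "0 \<le> s * (t + ln (vertex_value \<zeta> u \<omega>))" using s by simp
        then have "1 \<le> exp (s * t + s * ln (vertex_value \<zeta> u \<omega>))" by (simp add: distrib_left)
        then show ?thesis using True elim by (simp add: powr_def exp_add)
      qed simp
    qed
  qed
  then show ?thesis using value_event_measurable by simp
qed

text \<open>
  With \<open>V = e\<^sup>-\<^sup>x\<close>, the moment \<open>E V\<^bsup>s2\<^esup>\<close> is split according to \<open>x < a\<close>, \<open>a \<le> x \<le> t\<close> and \<open>x > t\<close>.
  The two outer parts are bounded by the moments of order \<open>s3\<close> and \<open>s1\<close> (exponential
  Chebyshev), and in the middle part \<open>V\<^bsup>s2\<^esup> \<le> e\<^bsup>-s2 a\<^esup>\<close>.
\<close>
lemma value_tail_lower:
  assumes s: "0 \<le> s1" "s1 \<le> s2" "s2 \<le> s3"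
    and int: "\<And>s. s \<in> {s1, s2, s3} \<Longrightarrow> integrable P (\<lambda>\<omega>. vertex_value \<zeta> u \<omega> powr s)"
  shows "exp (s2 * a) * (P.expectation (\<lambda>\<omega>. vertex_value \<zeta> u \<omega> powr s2)
       - exp ((s3 - s2) * a) * P.expectation (\<lambda>\<omega>. vertex_value \<zeta> u \<omega> powr s3)
       - exp (- (s2 - s1) * t) * P.expectation (\<lambda>\<omega>. vertex_value \<zeta> u \<omega> powr s1))
    \<le> P.prob {\<omega> \<in> space P. exp (- t) \<le> vertex_value \<zeta> u \<omega>}"
proof -
  let ?V = "vertex_value \<zeta> u"
  let ?A = "{\<omega> \<in> space P. exp (- t) \<le> ?V \<omega>}"
  have i: "integrable P (\<lambda>\<omega>. ?V \<omega> powr s1)" "integrable P (\<lambda>\<omega>. ?V \<omega> powr s2)" "integrable P (\<lambda>\<omega>. ?V \<omega> powr s3)"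
    using int by auto
  have "P.expectation (\<lambda>\<omega>. exp (s2 * a) * (?V \<omega> powr s2 - exp ((s3 - s2) * a) * ?V \<omega> powr s3
      - exp (- (s2 - s1) * t) * ?V \<omega> powr s1)) \<le> P.expectation (indicat_real ?A)"
  proof (rule integral_mono_AE)
    show "integrable P (indicat_real ?A)"
      using value_event_measurable by (intro integrable_real_indicator) (auto simp: P.emeasure_eq_measure)
    show "AE \<omega> in P. exp (s2 * a) * (?V \<omega> powr s2 - exp ((s3 - s2) * a) * ?V \<omega> powr s3
      - exp (- (s2 - s1) * t) * ?V \<omega> powr s1) \<le> indicat_real ?A \<omega>"
      using vertex_value_pos[of u] AE_space
    proof eventually_elim
      case (elim \<omega>)
      define x where "x = - ln (?V \<omega>)"
      have V: "?V \<omega> powr r = exp (- r * x)" for r using elim(1) by (simp add: powr_def x_def)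
      have A: "\<omega> \<in> ?A \<longleftrightarrow> x \<le> t"
        using elim by (auto simp: x_def ln_ge_iff[symmetric])
      let ?B = "exp (- s2 * x) - exp ((s3 - s2) * a) * exp (- s3 * x) - exp (- (s2 - s1) * t) * exp (- s1 * x)"
      have "exp (s2 * a) * ?B \<le> indicat_real ?A \<omega>"
      proof -
        consider "t < x" | "x \<le> t" "x < a" | "x \<le> t" "a \<le> x" by linarith
        then show ?thesis
        proof cases
          case 1
          have "(s2 - s1) * t \<le> (s2 - s1) * x" using 1 s by (intro mult_left_mono) auto
          then have "exp (- s2 * x) \<le> exp (- (s2 - s1) * t) * exp (- s1 * x)"
            unfolding exp_add[symmetric] exp_le_cancel_iff by (simp add: algebra_simps)
          moreover have "0 \<le> exp ((s3 - s2) * a) * exp (- s3 * x)" by simp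
          ultimately have "?B \<le> 0" by linarith
          then have "exp (s2 * a) * ?B \<le> 0" by (intro mult_nonneg_nonpos) auto
          then show ?thesis by (meson indicator_pos_le order_trans)
        next
          case 2
          have "(s3 - s2) * x \<le> (s3 - s2) * a" using 2 s by (intro mult_left_mono) auto
          then have "exp (- s2 * x) \<le> exp ((s3 - s2) * a) * exp (- s3 * x)"
            unfolding exp_add[symmetric] exp_le_cancel_iff by (simp add: algebra_simps)
          moreover have "0 \<le> exp (- (s2 - s1) * t) * exp (- s1 * x)" by simp
          ultimately have "?B \<le> 0" by linarith
          then have "exp (s2 * a) * ?B \<le> 0" by (intro mult_nonneg_nonpos) auto
          then show ?thesis by (meson indicator_pos_le order_trans)
        next
          case 3
          have "0 \<le> exp ((s3 - s2) * a) * exp (- s3 * x)" "0 \<le> exp (- (s2 - s1) * t) * exp (- s1 * x)"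
            by simp_all
          then have "?B \<le> exp (- s2 * x)" by linarith
          then have "exp (s2 * a) * ?B \<le> exp (s2 * a) * exp (- s2 * x)" by (intro mult_left_mono) auto
          also have "\<dots> \<le> 1"
          proof -
            have "s2 * a \<le> s2 * x" using 3 s by (intro mult_left_mono) auto
            then show ?thesis unfolding exp_add[symmetric] by simp
          qed
          finally show ?thesis using A 3 by (simp add: indicator_def)
        qed
      qed
      then show ?case unfolding V .
    qed
  qed (intro integrable_mult_right Bochner_Integration.integrable_diff i)
  then show ?thesis using value_event_measurable i by simp
qed

section \<open>Exponential bounds for the expected count\<close>

text \<open>
  Every level is finite, so its part of the count is a finite sum of indicators; the levels
  themselves are summed by monotone convergence.
\<close>
lemma expected_Z_eq:
  "expected_Z P \<zeta> x = (\<Sum>n. ennreal (\<Sum>u | length u = n. P.prob {\<omega> \<in> space P. x \<le> vertex_value \<zeta> u \<omega>}))"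
proof -
  let ?A = "\<lambda>u. {\<omega> \<in> space P. x \<le> vertex_value \<zeta> u \<omega>}"
  have Z: "Z_count \<zeta> x \<omega> = (\<Sum>n. \<Sum>u | length u = n. indicator (?A u) \<omega>)" if \<omega>: "\<omega> \<in> space P" for \<omega>
  proof -
    define L where "L = (\<lambda>n. {u. length u = n \<and> x \<le> vertex_value \<zeta> u \<omega>})"
    have fin: "finite (L n)" for n
      by (rule finite_subset[OF _ finite_length_eq[of n]]) (auto simp: L_def)
    have "{u. x \<le> vertex_value \<zeta> u \<omega>} = (\<Union>n. L n)" by (auto simp: L_def)
    then have "Z_count \<zeta> x \<omega> = emeasure (count_space UNIV) (\<Union>n. L n)"
      by (simp add: Z_count_def)
    also have "\<dots> = (\<Sum>n. emeasure (count_space UNIV) (L n))"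
      by (rule suminf_emeasure[symmetric]) (auto simp: disjoint_family_on_def L_def)
    also have "\<dots> = (\<Sum>n. \<Sum>u | length u = n. indicator (?A u) \<omega>)"
    proof (rule suminf_cong)
      fix n
      have "emeasure (count_space UNIV) (L n) = of_nat (card (L n))"
        by (rule emeasure_count_space_finite) (auto simp: fin)
      also have "\<dots> = (\<Sum>u\<in>L n. 1)" by simp
      also have "\<dots> = (\<Sum>u | length u = n. indicator (?A u) \<omega>)"
        using \<omega> finite_length_eq[of n]
        by (intro sum.mono_neutral_cong_left) (auto simp: L_def)
      finally show "emeasure (count_space UNIV) (L n) = (\<Sum>u | length u = n. indicator (?A u) \<omega>)" .
    qed
    finally show ?thesis .
  qed
  have "expected_Z P \<zeta> x = (\<integral>\<^sup>+\<omega>. (\<Sum>n. \<Sum>u | length u = n. indicator (?A u) \<omega>) \<partial>P)"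
    unfolding expected_Z_def by (rule nn_integral_cong) (rule Z)
  also have "\<dots> = (\<Sum>n. \<integral>\<^sup>+\<omega>. (\<Sum>u | length u = n. indicator (?A u) \<omega>) \<partial>P)"
    by (rule nn_integral_suminf) (intro borel_measurable_sum borel_measurable_indicator value_event_measurable)
  also have "\<dots> = (\<Sum>n. ennreal (\<Sum>u | length u = n. P.prob (?A u)))"
  proof (rule suminf_cong)
    fix n
    have "(\<integral>\<^sup>+\<omega>. (\<Sum>u | length u = n. indicator (?A u) \<omega>) \<partial>P)
        = (\<Sum>u | length u = n. \<integral>\<^sup>+\<omega>. indicator (?A u) \<omega> \<partial>P)"
      by (rule nn_integral_sum) (intro borel_measurable_indicator value_event_measurable)
    also have "\<dots> = (\<Sum>u | length u = n. ennreal (P.prob (?A u)))"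
      using value_event_measurable by (intro sum.cong) (simp_all add: P.emeasure_eq_measure)
    also have "\<dots> = ennreal (\<Sum>u | length u = n. P.prob (?A u))" by (rule sum_ennreal) simp
    finally show "(\<integral>\<^sup>+\<omega>. (\<Sum>u | length u = n. indicator (?A u) \<omega>) \<partial>P) = ennreal (\<Sum>u | length u = n. P.prob (?A u))" .
  qed
  finally show ?thesis .
qed

lemma expected_Z_mono: "x \<le> y \<Longrightarrow> expected_Z P \<zeta> y \<le> expected_Z P \<zeta> x"
  unfolding expected_Z_def Z_count_def
  by (intro nn_integral_mono emeasure_mono) auto

lemma card_level: "card {u :: 'c list. length u = n} = CARD('c) ^ n"
  using card_lists_length_eq[of "UNIV :: 'c set" n] by simp

lemma expected_Z_upper:
  assumes s: "0 \<le> s" "s \<in> moment_domain N \<xi>" and rho: "rho N \<xi> s < 1"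
  shows "\<exists>C>0. \<forall>t. expected_Z P \<zeta> (exp (- t)) \<le> ennreal (C * exp (s * t))"
proof -
  obtain b where b: "0 < b" "\<forall>u. integrable P (\<lambda>\<omega>. vertex_value \<zeta> u \<omega> powr s) \<and>
      P.expectation (\<lambda>\<omega>. vertex_value \<zeta> u \<omega> powr s) \<le> b * (rho N \<xi> s / real CARD('c)) ^ length u"
    using vertex_moment_bounds[OF s(2)] by blast
  have r: "0 < rho N \<xi> s" by (rule labels.rho_pos[OF s(2)])
  have "expected_Z P \<zeta> (exp (- t)) \<le> ennreal (b / (1 - rho N \<xi> s) * exp (s * t))" for t
  proof -
    let ?p = "\<lambda>u. P.prob {\<omega> \<in> space P. exp (- t) \<le> vertex_value \<zeta> u \<omega>}"
    have level: "(\<Sum>u | length u = n. ?p u) \<le> exp (s * t) * b * rho N \<xi> s ^ n" for n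
    proof -
      have "(\<Sum>u | length u = n. ?p u) \<le> (\<Sum>u :: 'c list | length u = n. exp (s * t) * (b * (rho N \<xi> s / real CARD('c)) ^ n))"
      proof (rule sum_mono)
        fix u :: "'c list" assume "u \<in> {u. length u = n}"
        then have n: "length u = n" by simp
        have "?p u \<le> exp (s * t) * P.expectation (\<lambda>\<omega>. vertex_value \<zeta> u \<omega> powr s)"
          using b(2) by (intro value_tail_upper s(1)) simp
        also have "\<dots> \<le> exp (s * t) * (b * (rho N \<xi> s / real CARD('c)) ^ n)"
          using b(2)[rule_format, of u] n by (intro mult_left_mono) auto
        finally show "?p u \<le> exp (s * t) * (b * (rho N \<xi> s / real CARD('c)) ^ n)" .
      qed
      also have "\<dots> = exp (s * t) * b * rho N \<xi> s ^ n"
        by (simp add: card_level power_divide)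
      finally show ?thesis .
    qed
    have "expected_Z P \<zeta> (exp (- t)) \<le> (\<Sum>n. ennreal (exp (s * t) * b * rho N \<xi> s ^ n))"
      unfolding expected_Z_eq by (intro suminf_le ennreal_leI level) auto
    also have "\<dots> = ennreal (\<Sum>n. exp (s * t) * b * rho N \<xi> s ^ n)"
      using b(1) r rho by (intro suminf_ennreal2 summable_mult summable_geometric) auto
    also have "(\<Sum>n. exp (s * t) * b * rho N \<xi> s ^ n) = b / (1 - rho N \<xi> s) * exp (s * t)"
      using r rho by (simp add: suminf_mult suminf_geometric summable_geometric)
    finally show ?thesis .
  qed
  moreover have "0 < b / (1 - rho N \<xi> s)" using b(1) rho by simp
  ultimately show ?thesis by blast
qed

text \<open>
  Level \<open>n\<close> alone contributes at least \<open>e\<^bsup>s2 a n\<^esup> \<rho>(s2)\<^sup>n (a2 - b3 q3\<^sup>n - b1 q1\<^sup>n)\<close> by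
  \<open>value_tail_lower\<close> with the window \<open>[a n, b n]\<close>. The two slope conditions say precisely that \<open>q3 < 1\<close> and \<open>q1 < 1\<close>.
\<close>
lemma expected_Z_lower:
  assumes s: "0 \<le> s1" "s1 < s2" "s2 < s3" and dom: "{s1, s2, s3} \<subseteq> moment_domain N \<xi>"
    and rho2: "0 < ln (rho N \<xi> s2)" and ab: "0 < a" "0 < b"
    and slope3: "ln (rho N \<xi> s3) - ln (rho N \<xi> s2) < - (s3 - s2) * a"
    and slope1: "ln (rho N \<xi> s1) - ln (rho N \<xi> s2) < (s2 - s1) * b"
  shows "\<exists>\<kappa>>0. eventually (\<lambda>t. ennreal (\<kappa> * exp (s2 * a / b * t)) \<le> expected_Z P \<zeta> (exp (- t))) at_top"
proof -
  let ?r = "rho N \<xi>"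
  have r: "0 < ?r s1" "0 < ?r s2" "0 < ?r s3" using dom by (auto intro: labels.rho_pos)
  have r2: "1 \<le> ?r s2" using rho2 r(2) by (simp add: ln_gt_zero_iff)
  have D: "s1 \<in> moment_domain N \<xi>" "s2 \<in> moment_domain N \<xi>" "s3 \<in> moment_domain N \<xi>" using dom by auto
  let ?E = "\<lambda>u s. P.expectation (\<lambda>\<omega>. vertex_value \<zeta> u \<omega> powr s)"
  let ?d = "real CARD('c)"
  obtain b1 where b1: "0 < b1" "\<forall>u. integrable P (\<lambda>\<omega>. vertex_value \<zeta> u \<omega> powr s1) \<and> ?E u s1 \<le> b1 * (?r s1 / ?d) ^ length u"
    using vertex_moment_bounds[OF D(1)] by blast
  obtain a2 where a2: "0 < a2" "\<forall>u. integrable P (\<lambda>\<omega>. vertex_value \<zeta> u \<omega> powr s2) \<and> a2 * (?r s2 / ?d) ^ length u \<le> ?E u s2"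
    using vertex_moment_bounds[OF D(2)] by blast
  obtain b3 where b3: "0 < b3" "\<forall>u. integrable P (\<lambda>\<omega>. vertex_value \<zeta> u \<omega> powr s3) \<and> ?E u s3 \<le> b3 * (?r s3 / ?d) ^ length u"
    using vertex_moment_bounds[OF D(3)] by blast
  define q1 where "q1 = exp (- (s2 - s1) * b) * (?r s1 / ?r s2)"
  define q3 where "q3 = exp ((s3 - s2) * a) * (?r s3 / ?r s2)"
  have q1: "0 < q1" "q1 < 1"
  proof -
    have "?r s1 / ?r s2 = exp (ln (?r s1) - ln (?r s2))" using r by (simp add: exp_diff)
    then have "q1 = exp (- (s2 - s1) * b + (ln (?r s1) - ln (?r s2)))" by (simp only: q1_def exp_add)
    then show "0 < q1" "q1 < 1" using slope1 by (auto simp: algebra_simps)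
  qed
  have q3: "0 < q3" "q3 < 1"
  proof -
    have "?r s3 / ?r s2 = exp (ln (?r s3) - ln (?r s2))" using r by (simp add: exp_diff)
    then have "q3 = exp ((s3 - s2) * a + (ln (?r s3) - ln (?r s2)))" by (simp only: q3_def exp_add)
    then show "0 < q3" "q3 < 1" using slope3 by (auto simp: algebra_simps)
  qed
  have level: "exp (s2 * a * n) * (a2 - b3 * q3 ^ n - b1 * q1 ^ n)
      \<le> (\<Sum>u | length u = n. P.prob {\<omega> \<in> space P. exp (- (b * n)) \<le> vertex_value \<zeta> u \<omega>})"
    if pos: "0 \<le> a2 - b3 * q3 ^ n - b1 * q1 ^ n" for n :: nat
  proof -
    let ?X = "exp (s2 * (a * n)) * (a2 * (?r s2 / ?d) ^ n
          - exp ((s3 - s2) * (a * n)) * (b3 * (?r s3 / ?d) ^ n)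
          - exp (- (s2 - s1) * (b * n)) * (b1 * (?r s1 / ?d) ^ n))"
    have ratio: "(?r s3 / ?d) ^ n = (?r s3 / ?r s2) ^ n * (?r s2 / ?d) ^ n"
      "(?r s1 / ?d) ^ n = (?r s1 / ?r s2) ^ n * (?r s2 / ?d) ^ n"
      using r by (simp_all flip: power_mult_distrib)
    have exps: "exp ((s3 - s2) * (a * n)) = exp ((s3 - s2) * a) ^ n"
      "exp (- (s2 - s1) * (b * n)) = exp (- (s2 - s1) * b) ^ n"
      unfolding exp_of_nat_mult[symmetric] by (simp_all only: mult_ac)
    have X: "?X = (?r s2 / ?d) ^ n * (exp (s2 * a * n) * (a2 - b3 * q3 ^ n - b1 * q1 ^ n))"
      unfolding exps ratio q1_def q3_def power_mult_distrib by (simp only: algebra_simps)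
    have "exp (s2 * a * n) * (a2 - b3 * q3 ^ n - b1 * q1 ^ n)
        \<le> ?r s2 ^ n * (exp (s2 * a * n) * (a2 - b3 * q3 ^ n - b1 * q1 ^ n))"
      using mult_right_mono[of 1 "?r s2 ^ n" "exp (s2 * a * n) * (a2 - b3 * q3 ^ n - b1 * q1 ^ n)"] r2 pos
      by simp
    also have "\<dots> = ?d ^ n * ?X"
      unfolding X by (simp add: power_divide)
    also have "\<dots> = (\<Sum>u :: 'c list | length u = n. ?X)" by (simp add: card_level)
    also have "\<dots> \<le> (\<Sum>u | length u = n. P.prob {\<omega> \<in> space P. exp (- (b * n)) \<le> vertex_value \<zeta> u \<omega>})"
    proof (rule sum_mono)
      fix u :: "'c list" assume "u \<in> {u. length u = n}"
      then have n: "length u = n" by simp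
      have "?X \<le> exp (s2 * (a * n)) * (?E u s2 - exp ((s3 - s2) * (a * n)) * ?E u s3
          - exp (- (s2 - s1) * (b * n)) * ?E u s1)"
        using a2(2)[rule_format, of u] b3(2)[rule_format, of u] b1(2)[rule_format, of u] unfolding n
        by (intro mult_left_mono diff_mono) simp_all
      also have "\<dots> \<le> P.prob {\<omega> \<in> space P. exp (- (b * n)) \<le> vertex_value \<zeta> u \<omega>}"
        using s b1(2) a2(2) b3(2) by (intro value_tail_lower) auto
      finally show "?X \<le> P.prob {\<omega> \<in> space P. exp (- (b * n)) \<le> vertex_value \<zeta> u \<omega>}" .
    qed
    finally show ?thesis .
  qed
  have "(\<lambda>n. b3 * q3 ^ n + b1 * q1 ^ n) \<longlonglongrightarrow> b3 * 0 + b1 * 0"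
    using q1 q3 by (intro tendsto_intros LIMSEQ_realpow_zero) auto
  then have "eventually (\<lambda>n. b3 * q3 ^ n + b1 * q1 ^ n < a2 / 2) sequentially"
    by (rule order_tendstoD) (use a2(1) in simp)
  then have "eventually (\<lambda>n. ennreal (a2 / 2 * exp (s2 * a * real n)) \<le> expected_Z P \<zeta> (exp (- (b * real n)))) sequentially"
  proof eventually_elim
    case (elim n)
    let ?S = "\<lambda>n. \<Sum>u | length u = n. P.prob {\<omega> \<in> space P. exp (- (b * real n)) \<le> vertex_value \<zeta> u \<omega>}"
    have "a2 / 2 * exp (s2 * a * real n) \<le> exp (s2 * a * real n) * (a2 - b3 * q3 ^ n - b1 * q1 ^ n)"
      using elim by (subst mult.commute) (intro mult_left_mono, auto)
    also have "\<dots> \<le> ?S n" using elim a2(1) by (intro level) linarith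
    finally have "ennreal (a2 / 2 * exp (s2 * a * real n)) \<le> ennreal (?S n)" by (rule ennreal_leI)
    also have "\<dots> \<le> expected_Z P \<zeta> (exp (- (b * real n)))"
      unfolding expected_Z_eq
      using sum_le_suminf[of "\<lambda>k. ennreal (\<Sum>u | length u = k. P.prob {\<omega> \<in> space P. exp (- (b * real n)) \<le> vertex_value \<zeta> u \<omega>})" "{n}"]
      by simp
    finally show ?case .
  qed
  moreover have "filterlim (\<lambda>t. nat \<lfloor>t / b\<rfloor>) sequentially at_top"
  proof -
    have "filterlim (\<lambda>t. 1 / b * t) at_top at_top"
      using ab(2) by (intro filterlim_tendsto_pos_mult_at_top[OF tendsto_const _ filterlim_ident]) simp
    then have "filterlim (\<lambda>t. t / b) at_top at_top" by simp
    then show ?thesis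
      by (intro filterlim_compose[OF filterlim_nat_sequentially] filterlim_compose[OF filterlim_floor_sequentially])
  qed
  ultimately have "eventually (\<lambda>t. ennreal (a2 / 2 * exp (s2 * a * real (nat \<lfloor>t / b\<rfloor>)))
      \<le> expected_Z P \<zeta> (exp (- (b * real (nat \<lfloor>t / b\<rfloor>))))) at_top"
    by (rule eventually_compose_filterlim)
  then have "eventually (\<lambda>t. ennreal (a2 / 2 * exp (- (s2 * a)) * exp (s2 * a / b * t)) \<le> expected_Z P \<zeta> (exp (- t))) at_top"
    using eventually_gt_at_top[of 0]
  proof eventually_elim
    case (elim t)
    (* The largest level n with b n <= t; rounding costs a factor exp (- s2 a) at most. *)
    define n where "n = nat \<lfloor>t / b\<rfloor>"
    have "real n = of_int \<lfloor>t / b\<rfloor>" using elim(2) ab by (simp add: n_def)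
    then have n: "real n \<le> t / b" "t / b - 1 \<le> real n" by linarith+
    have "s2 * a * (t / b - 1) \<le> s2 * a * real n" using n(2) s ab by (intro mult_left_mono) auto
    then have "- (s2 * a) + s2 * a / b * t \<le> s2 * a * real n" by (simp add: algebra_simps)
    then have "exp (- (s2 * a)) * exp (s2 * a / b * t) \<le> exp (s2 * a * real n)"
      unfolding exp_add[symmetric] by simp
    then have "a2 / 2 * (exp (- (s2 * a)) * exp (s2 * a / b * t)) \<le> a2 / 2 * exp (s2 * a * real n)"
      using a2(1) by (intro mult_left_mono) auto
    then have "ennreal (a2 / 2 * exp (- (s2 * a)) * exp (s2 * a / b * t)) \<le> ennreal (a2 / 2 * exp (s2 * a * real n))"
      unfolding mult.assoc[symmetric] by (rule ennreal_leI)
    also have "\<dots> \<le> expected_Z P \<zeta> (exp (- (b * real n)))" using elim(1) by (simp only: n_def)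
    also have "\<dots> \<le> expected_Z P \<zeta> (exp (- t))"
      using n(1) ab by (intro expected_Z_mono) (simp add: field_simps)
    finally show ?case .
  qed
  moreover have "0 < a2 / 2 * exp (- (s2 * a))" using a2(1) by simp
  ultimately show ?thesis by blast
qed

end

section \<open>The growth rate\<close>

text \<open>
  Constant factors disappear after division by \<open>t\<close>, so two-sided exponential bounds with rates
  arbitrarily close to \<open>\<alpha>\<close> suffice. They also make \<open>g t\<close> finite and positive for large \<open>t\<close>, where \<open>ln_ennreal\<close> is the real
  logarithm.
\<close>
lemma ln_ennreal_growth_rate:
  fixes g :: "real \<Rightarrow> ennreal"
  assumes upper: "\<And>\<epsilon>. 0 < \<epsilon> \<Longrightarrow> \<exists>C>0. \<forall>t>0. g t \<le> ennreal (C * exp ((\<alpha> + \<epsilon>) * t))"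
    and lower: "\<And>\<epsilon>. 0 < \<epsilon> \<Longrightarrow> \<exists>\<kappa>>0. eventually (\<lambda>t. ennreal (\<kappa> * exp ((\<alpha> - \<epsilon>) * t)) \<le> g t) at_top"
  shows "((\<lambda>t. ln_ennreal (g t) / ereal t) \<longlongrightarrow> ereal \<alpha>) at_top"
proof -
  have fin: "g t < \<top>" if t: "0 < t" for t
  proof -
    obtain C where "\<forall>t>0. g t \<le> ennreal (C * exp ((\<alpha> + 1) * t))"
      using upper[OF zero_less_one] by blast
    then have "g t \<le> ennreal (C * exp ((\<alpha> + 1) * t))" using t by simp
    then show ?thesis using ennreal_less_top by (rule le_less_trans)
  qed
  define h where "h = (\<lambda>t. ln (enn2real (g t)) / t)"
  have bounds: "eventually (\<lambda>t. 0 < enn2real (g t) \<and> \<bar>h t - \<alpha>\<bar> < e) at_top" if e: "0 < e" for e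
  proof -
    obtain C where C: "0 < C" "\<And>t. 0 < t \<Longrightarrow> g t \<le> ennreal (C * exp ((\<alpha> + e/2) * t))"
      using upper[of "e/2"] e by auto
    obtain \<kappa> where \<kappa>: "0 < \<kappa>" "eventually (\<lambda>t. ennreal (\<kappa> * exp ((\<alpha> - e/2) * t)) \<le> g t) at_top"
      using lower[of "e/2"] e by auto
    show ?thesis
      using \<kappa>(2) eventually_gt_at_top[of "max 0 (max (2 * ln C / e) (- 2 * ln \<kappa> / e))"]
    proof eventually_elim
      case (elim t)
      then have t: "0 < t" and tC: "ln C < e / 2 * t" and t\<kappa>: "- ln \<kappa> < e / 2 * t"
        using e by (auto simp: field_simps)
      define y where "y = enn2real (g t)"
      have g: "g t = ennreal y" using fin[OF t] by (simp add: y_def)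
      have y0: "0 \<le> y" by (simp add: y_def)
      have lo: "\<kappa> * exp ((\<alpha> - e/2) * t) \<le> y" and hi: "y \<le> C * exp ((\<alpha> + e/2) * t)"
        using elim(1) C(2)[OF t] y0 C(1) unfolding g by (auto simp: ennreal_le_iff)
      have pos: "0 < y" using \<kappa>(1) by (intro less_le_trans[OF _ lo]) simp
      have "ln (\<kappa> * exp ((\<alpha> - e/2) * t)) \<le> ln y" using \<kappa>(1) pos lo by simp
      then have "ln \<kappa> + (\<alpha> - e/2) * t \<le> ln y" using \<kappa>(1) by (simp add: ln_mult)
      moreover have "ln y \<le> ln (C * exp ((\<alpha> + e/2) * t))" using pos hi by simp
      then have "ln y \<le> ln C + (\<alpha> + e/2) * t" using C(1) by (simp add: ln_mult)
      ultimately have "(\<alpha> - e) * t < ln y" "ln y < (\<alpha> + e) * t"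
        using tC t\<kappa> by (simp_all add: algebra_simps)
      then have "\<alpha> - e < h t" "h t < \<alpha> + e"
        using t by (simp_all add: h_def y_def pos_less_divide_eq pos_divide_less_eq)
      then show ?case using pos by (auto simp: y_def abs_less_iff)
    qed
  qed
  have "(h \<longlongrightarrow> \<alpha>) at_top"
  proof (rule tendstoI)
    fix e :: real assume "0 < e"
    from bounds[OF this] show "eventually (\<lambda>t. dist (h t) \<alpha> < e) at_top"
      by eventually_elim (simp add: dist_real_def)
  qed
  then have "((\<lambda>t. ereal (h t)) \<longlongrightarrow> ereal \<alpha>) at_top" by simp
  moreover have "eventually (\<lambda>t. ereal (h t) = ln_ennreal (g t) / ereal t) at_top"
    using bounds[OF zero_less_one] eventually_gt_at_top[of 0]
  proof eventually_elim
    case (elim t)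
    have "g t \<noteq> 0" using elim(1) by auto
    then show ?case using fin[OF elim(2)] elim(2) by (simp add: ln_ennreal_def h_def)
  qed
  ultimately show ?thesis by (rule Lim_transform_eventually)
qed

theorem theorem2:
  fixes P :: "'w measure" and N :: "'v measure"
    and \<xi> :: "'c::finite \<Rightarrow> 'c \<Rightarrow> 'v \<Rightarrow> real"
    and root_colour :: 'c
    and c :: "'c list \<Rightarrow> 'w \<Rightarrow> 'c"
    and \<zeta> :: "'c list \<Rightarrow> 'c list \<Rightarrow> 'w \<Rightarrow> real"
    and \<mu> :: real
  assumes model: "coloured_tree P N \<xi> root_colour c \<zeta>"
    and i: "{0..1} \<subseteq> moment_domain N \<xi>" "0 \<in> interior (moment_domain N \<xi>)"
    and ii: "\<And>i j. integrable N (\<lambda>x. \<bar>ln (\<xi> i j x)\<bar>)"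
            "\<And>i j. integrable N (\<lambda>x. \<bar>\<xi> i j x * ln (\<xi> i j x)\<bar>)"
    and iii: "{0..} \<subseteq> moment_domain N \<xi>"
             "\<And>i j. C2_on {0..} (\<lambda>s. \<integral>x. \<xi> i j x powr s \<partial>N)"
    and A1: "(INF s\<in>{0..}. rho N \<xi> s) < 1"
    and mu_def: "\<mu> = - deriv (Lambda N \<xi>) 0"
    and A2: "\<mu> > 0"
  shows "\<exists>M :: real.
           (\<exists>u\<in>{0..\<mu>}. growth_quotient N \<xi> u = ereal M) \<and>
           (\<forall>u\<in>{0..\<mu>}. growth_quotient N \<xi> u \<le> ereal M) \<and>
           ((\<lambda>t. ln_ennreal (expected_Z P \<zeta> (exp (- t))) / ereal t) \<longlongrightarrow> ereal M) at_top"
proof -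
  interpret coloured_tree P N \<xi> root_colour c \<zeta> by (rule model)
  define f where "f = (\<lambda>s. ln (rho N \<xi> s))"
  have rho_pos: "0 < rho N \<xi> s" if "0 \<le> s" for s
    using that iii(1) by (intro labels.rho_pos) auto
  obtain r where r: "0 < r" "ball 0 r \<subseteq> moment_domain N \<xi>"
    using i(2) by (auto simp: mem_interior)
  define e where "e = r / 2"
  have e: "0 < e" "- e \<in> moment_domain N \<xi>" "e \<in> moment_domain N \<xi>"
  proof -
    have "- e \<in> ball 0 r" "e \<in> ball 0 r" using r(1) by (simp_all add: e_def)
    then show "- e \<in> moment_domain N \<xi>" "e \<in> moment_domain N \<xi>" using r(2) by blast+
  qed (use r(1) in \<open>simp add: e_def\<close>)
  have dom: "{-e<..} \<subseteq> moment_domain N \<xi>"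
  proof
    fix s assume s: "s \<in> {-e<..}"
    have "max 0 s \<in> moment_domain N \<xi>" using iii(1) by (rule subsetD) simp
    then show "s \<in> moment_domain N \<xi>"
      by (rule labels.moment_domain_between[OF e(2)]) (use s in auto)
  qed
  have conv: "convex_on {-e<..} f"
    unfolding f_def using dom by (intro labels.ln_rho_convex) auto
  have deriv_f: "(f has_real_derivative - \<mu>) (at 0)"
  proof -
    obtain D where "(rho N \<xi> has_real_derivative D) (at 0)"
      by (rule labels.rho_differentiable_at_0[OF e ii(1)])
    then have f': "(f has_real_derivative 1 / rho N \<xi> 0 * D) (at 0)"
      unfolding f_def using rho_pos[of 0] by (intro DERIV_chain2[OF DERIV_ln_divide]) auto
    then have "(Lambda N \<xi> has_real_derivative 1 / rho N \<xi> 0 * D - 0) (at 0)"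
      unfolding Lambda_def f_def by (intro DERIV_diff DERIV_const)
    then have "deriv (Lambda N \<xi>) 0 = 1 / rho N \<xi> 0 * D" by (intro DERIV_imp_deriv) simp
    then show ?thesis using f' mu_def by simp
  qed
  have f0: "0 < f 0" using degree by (simp add: f_def labels.rho_0)
  obtain s0 where s0: "0 \<le> s0" "f s0 < 0"
  proof -
    have "\<exists>y\<in>rho N \<xi> ` {0..}. y < 1" by (rule cInf_lessD[OF _ A1]) simp
    then obtain s where "0 \<le> s" "rho N \<xi> s < 1" by auto
    then show thesis using rho_pos[of s] by (intro that[of s]) (auto simp: f_def)
  qed
  obtain \<alpha> k where \<alpha>: "0 < \<alpha>" "f \<alpha> = 0" "\<alpha> < s0" and k: "0 < k" "k \<le> \<mu>"
    "\<forall>s>-e. k * (\<alpha> - s) \<le> f s"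
    by (rule convex_zero_slope[OF e(1) conv deriv_f f0 s0]) (rule that)
  have "growth_quotient N \<xi> k = ereal \<alpha>"
  proof (rule antisym)
    show "growth_quotient N \<xi> k \<le> ereal \<alpha>"
      using growth_quotient_le[OF k(1), of \<alpha> N \<xi>] \<alpha> by (simp add: f_def)
    show "ereal \<alpha> \<le> growth_quotient N \<xi> k"
    proof (rule le_growth_quotient[OF k(1)])
      fix s :: real assume "0 \<le> s"
      then have "- e < s" using e(1) by linarith
      then show "k * (\<alpha> - s) \<le> ln (rho N \<xi> s)" using k(3) by (simp add: f_def)
    qed
  qed
  moreover have "growth_quotient N \<xi> u \<le> ereal \<alpha>" if "u \<in> {0..\<mu>}" for u
  proof (cases "u = 0")
    case True
    then show ?thesis using growth_quotient_0[of s0 N \<xi>] s0 by (simp add: f_def)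
  next
    case False
    then show ?thesis
      using growth_quotient_le[of u \<alpha> N \<xi>] \<alpha> that by (simp add: f_def)
  qed
  moreover have "((\<lambda>t. ln_ennreal (expected_Z P \<zeta> (exp (- t))) / ereal t) \<longlongrightarrow> ereal \<alpha>) at_top"
  proof (rule ln_ennreal_growth_rate)
    fix \<epsilon> :: real assume \<epsilon>: "0 < \<epsilon>"
    (* To the right of alpha but still left of s0, where convexity keeps f negative. *)
    define s where "s = min (\<alpha> + \<epsilon>) ((\<alpha> + s0) / 2)"
    have s: "\<alpha> < s" "s < s0" "s \<le> \<alpha> + \<epsilon>" using \<alpha>(3) \<epsilon> by (simp_all add: s_def min_less_iff_disj)
    have "f s < 0"
      by (rule convex_negative_right_of_zero[OF conv _ \<alpha>(2) _ s0(2) \<alpha>(3) s(1,2)])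
        (use \<alpha> s0 e(1) in simp_all)
    then have rho: "rho N \<xi> s < 1" using rho_pos[of s] s \<alpha> by (simp add: f_def)
    have "0 \<le> s" using s \<alpha> by simp
    moreover from this have "s \<in> moment_domain N \<xi>" by (intro subsetD[OF iii(1)]) simp
    ultimately have dom_s: "0 \<le> s" "s \<in> moment_domain N \<xi>" .
    from expected_Z_upper[OF dom_s rho] obtain C
      where C: "0 < C" "\<forall>t. expected_Z P \<zeta> (exp (- t)) \<le> ennreal (C * exp (s * t))"
      by blast
    have bound: "expected_Z P \<zeta> (exp (- t)) \<le> ennreal (C * exp ((\<alpha> + \<epsilon>) * t))" if "0 < t" for t
    proof -
      have "s * t \<le> (\<alpha> + \<epsilon>) * t" using s(3) that by (intro mult_right_mono) auto
      then have "C * exp (s * t) \<le> C * exp ((\<alpha> + \<epsilon>) * t)"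
        using C(1) by (intro mult_left_mono) auto
      then show ?thesis by (rule order_trans[OF C(2)[rule_format] ennreal_leI])
    qed
    show "\<exists>C>0. \<forall>t>0. expected_Z P \<zeta> (exp (- t)) \<le> ennreal (C * exp ((\<alpha> + \<epsilon>) * t))"
      by (intro exI[of _ C] conjI allI impI C(1) bound)
  next
    fix \<epsilon> :: real assume \<epsilon>: "0 < \<epsilon>"
    have sub: "{0..\<alpha>} \<subseteq> {-e<..}" using e(1) by auto
    have k_sub: "k * (\<alpha> - s) \<le> f s" if "s \<in> {-e<..}" for s using k(3) that by simp
    obtain s1 s2 s3 a b where s: "0 \<le> s1" "s1 < s2" "s2 < s3" and f2: "0 < f s2"
      and ab: "0 < a" "0 < b" and close: "\<alpha> - \<epsilon> < s2 * a / b"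
      and slopes: "f s3 - f s2 < - (s3 - s2) * a" "f s1 - f s2 < (s2 - s1) * b"
      by (rule convex_almost_linear_left_of_zero[OF conv sub \<alpha>(1,2) k(1) k_sub \<epsilon>]) (assumption, rule that)
    have "{s1, s2, s3} \<subseteq> moment_domain N \<xi>"
      by (rule order_trans[OF _ iii(1)]) (use s in simp)
    from expected_Z_lower[OF s this f2[unfolded f_def] ab slopes[unfolded f_def]]
    obtain \<kappa> where \<kappa>: "0 < \<kappa>"
      "eventually (\<lambda>t. ennreal (\<kappa> * exp (s2 * a / b * t)) \<le> expected_Z P \<zeta> (exp (- t))) at_top"
      by blast
    have bound: "eventually (\<lambda>t. ennreal (\<kappa> * exp ((\<alpha> - \<epsilon>) * t)) \<le> expected_Z P \<zeta> (exp (- t))) at_top"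
      using \<kappa>(2) eventually_gt_at_top[of 0]
    proof eventually_elim
      case (elim t)
      have "(\<alpha> - \<epsilon>) * t \<le> s2 * a / b * t" using close elim(2) by (intro mult_right_mono) auto
      then have "\<kappa> * exp ((\<alpha> - \<epsilon>) * t) \<le> \<kappa> * exp (s2 * a / b * t)"
        using \<kappa>(1) by (intro mult_left_mono) auto
      then show ?case by (rule order_trans[OF ennreal_leI elim(1)])
    qed
    show "\<exists>\<kappa>>0. eventually (\<lambda>t. ennreal (\<kappa> * exp ((\<alpha> - \<epsilon>) * t)) \<le> expected_Z P \<zeta> (exp (- t))) at_top"
      by (intro exI[of _ \<kappa>] conjI \<kappa>(1) bound)
  qed
  ultimately show ?thesis using k(1,2) by (intro exI[of _ \<alpha>]) auto
qed

end
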